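(* Let $A \in \mathbb{F}_2[x]$ be a nonzero polynomial. Then $A$ is an even perfect polynomial with exactly four distinct irreducible factors (i.e. $\sigma(A) = A$, $\gcd(A, x^2+x) \neq 1$ and $\omega(A) = 4$) if and only if $A$ is one of the following five polynomials: $$\begin{array}{l} C_1(x) = x^2(x+1)(x^2+x+1)^2(x^4+x+1),\\ C_2(x) = C_1(x+1),\\ C_3(x) = x^4(x+1)^4(x^4+x^3+x^2+x+1)(x^4+x^3+1),\\ C_4(x) = x^6(x+1)^3(x^3+x^2+1)(x^3+x+1),\\ C_5(x) = C_4(x+1). \end{array}$$
   Context: For a nonzero $A \in \mathbb{F}_2[x]$, $\sigma(A) = \sum_{D \mid A} D$ denotes the sum of all divisors $D \in \mathbb{F}_2[x]$ of $A$, and $\omega(A)$ denotes the number of distinct prime (irreducible) polynomials in $\mathbb{F}_2[x]$ dividing $A$. The polynomial $A$ is called perfect if $\sigma(A) = A$. It is called even if $\gcd(A, x^2+x) \neq 1$, i.e. if it has a linear factor ($x$ or $x+1$). *)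

theory Defs
  imports "HOL-Computational_Algebra.Computational_Algebra" "HOL-Computational_Algebra.Field_as_Ring" "HOL-Library.Z2"
begin

(* The field F_2 is the library type bit. The instances below are the ones Field_as_Ring provides
   for real, rat and complex; they are needed for gcd on bit poly. *)

instantiation bit ::
  "{unique_euclidean_ring, normalization_euclidean_semiring, normalization_semidom_multiplicative}"
begin

definition [simp]: "normalize_bit = (normalize_field :: bit \<Rightarrow> _)"
definition [simp]: "unit_factor_bit = (unit_factor_field :: bit \<Rightarrow> _)"
definition [simp]: "euclidean_size_bit = (euclidean_size_field :: bit \<Rightarrow> _)"
definition [simp]: "division_segment (x :: bit) = 1"

instance
proof
  fix a b c q r :: bit
  show "unit_factor a * normalize a = a" by (cases a) auto
  show "a \<noteq> 0 \<Longrightarrow> is_unit (unit_factor a)" by (cases a) auto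
  show "b \<noteq> 0 \<Longrightarrow> euclidean_size (a mod b) < euclidean_size b" by (cases a; cases b) auto
  show "b \<noteq> 0 \<Longrightarrow> euclidean_size a \<le> euclidean_size (a * b)" by (cases a; cases b) auto
  show "b \<noteq> 0 \<Longrightarrow> division_segment r = division_segment b \<Longrightarrow> euclidean_size r < euclidean_size b
    \<Longrightarrow> (q * b + r) div b = q" by (cases b; cases r; cases q) auto
qed (auto simp: dvd_field_iff)

end

instantiation bit :: euclidean_ring_gcd
begin

definition gcd_bit :: "bit \<Rightarrow> bit \<Rightarrow> bit" where
  "gcd_bit = Euclidean_Algorithm.gcd"
definition lcm_bit :: "bit \<Rightarrow> bit \<Rightarrow> bit" where
  "lcm_bit = Euclidean_Algorithm.lcm"
definition Gcd_bit :: "bit set \<Rightarrow> bit" where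
  "Gcd_bit = Euclidean_Algorithm.Gcd"
definition Lcm_bit :: "bit set \<Rightarrow> bit" where
  "Lcm_bit = Euclidean_Algorithm.Lcm"

instance by standard (simp_all add: gcd_bit_def lcm_bit_def Gcd_bit_def Lcm_bit_def)

end

instance bit :: field_gcd ..

abbreviation pX :: "bit poly" where
  "pX \<equiv> [:0, 1:]"

(* Meaningful only for A \<noteq> 0: every polynomial divides 0, and the sum and the cardinality over
   an infinite set are 0 by convention. The only unit of F_2[x] is 1, so associates coincide and
   each divisor is counted once. *)

definition sigma :: "bit poly \<Rightarrow> bit poly" where
  "sigma A = (\<Sum>D | D dvd A. D)"

definition omega :: "bit poly \<Rightarrow> nat" where
  "omega A = card {P. irreducible P \<and> P dvd A}"

definition perfect_poly :: "bit poly \<Rightarrow> bool" where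
  "perfect_poly A \<longleftrightarrow> sigma A = A"

(* Not the library's even, which means divisibility by 2 (and 2 = 0 here). *)
definition even_poly :: "bit poly \<Rightarrow> bool" where
  "even_poly A \<longleftrightarrow> gcd A (pX ^ 2 + pX) \<noteq> 1"

definition C1 :: "bit poly" where
  "C1 = pX ^ 2 * (pX + 1) * (pX ^ 2 + pX + 1) ^ 2 * (pX ^ 4 + pX + 1)"

definition C2 :: "bit poly" where
  "C2 = C1 \<circ>\<^sub>p (pX + 1)"

definition C3 :: "bit poly" where
  "C3 = pX ^ 4 * (pX + 1) ^ 4 * (pX ^ 4 + pX ^ 3 + pX ^ 2 + pX + 1) * (pX ^ 4 + pX ^ 3 + 1)"

definition C4 :: "bit poly" where
  "C4 = pX ^ 6 * (pX + 1) ^ 3 * (pX ^ 3 + pX ^ 2 + 1) * (pX ^ 3 + pX + 1)"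

definition C5 :: "bit poly" where
  "C5 = C4 \<circ>\<^sub>p (pX + 1)"

end

theory Submission
  imports Defs
begin

text \<open>
  Write \<open>X\<close> for one of the two linear polynomials over the field with two elements; the other one is
  \<open>X + 1\<close>.  The sum-of-divisors function is multiplicative and sends a prime power \<open>p ^ n\<close> to
  \<open>1 + p + \<dots> + p ^ n\<close>, here called \<open>geo (n + 1) p\<close>.  Evaluation at the two points of the field shows
  that a perfect polynomial divisible by one linear polynomial is divisible by the other as well
  (\<open>perfect_linear_factor\<close>).  So an even perfect polynomial with four prime divisors has the form
  \<open>A = X ^ a * (X + 1) ^ b * P ^ c * Q ^ d\<close>, where we may order \<open>degree P \<le> degree Q\<close>.

  In characteristic two, \<open>geo (2 ^ t * m) p = (1 + p) ^ (2 ^ t - 1) * geo m p ^ 2 ^ t\<close>.  This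
  reduces everything to \<open>geo m p\<close> with \<open>m\<close> odd, which is never divisible by a linear polynomial when
  \<open>p\<close> is one of the four primes.  Let \<open>geo m p\<close> be one of the four odd parts that arise from \<open>A\<close>, so
  that it divides \<open>A\<close>.  Then \<open>geo m X\<close> is squarefree, hence one of \<open>1\<close>, \<open>P\<close>, \<open>Q\<close>, \<open>P * Q\<close>, and
  similarly for \<open>X + 1\<close>; \<open>geo m P\<close> is a power of \<open>Q\<close>, and a derivative argument bounds the exponent by one
  (\<open>geo_eq_prime_power\<close>); \<open>geo m Q\<close> is \<open>1\<close> by degree.  It follows that
  \<open>P + 1 = X ^ i * (X + 1) ^ j\<close> and \<open>Q + 1 = X ^ k * (X + 1) ^ l * P ^ s\<close>, and comparing exponents in
  \<open>sigma A = A\<close> gives four equations between natural numbers (\<open>perfect_exponents_exist\<close>).  The one for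
  \<open>Q\<close> says that \<open>2 ^ \<delta> - 1\<close> is a sum of at most three powers of two, one for each of the first
  three factors, and this leaves few cases.

  In each case one knows which of \<open>P\<close>, \<open>Q\<close>, \<open>P * Q\<close> are of the form \<open>geo u X\<close>.  Since
  \<open>geo u X + 1 = X * (X + 1) ^ (2 ^ t - 1) * geo m X ^ 2 ^ t\<close> for \<open>u = 2 ^ t * m + 1\<close>, an identity
  \<open>P = geo u X\<close> forces \<open>u = 2 ^ t + 1\<close>, and \<open>Q = geo u X\<close> is almost as restrictive.  The exponent
  equations alone still admit infinitely many solutions, which are excluded by three facts about
  polynomials.

  \<^item> \<open>geo (2 ^ t + 1) X\<close> is reducible for \<open>t \<ge> 3\<close> (\<open>geo_Fermat_irreducible\<close>): modulo this polynomial,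
    \<open>\<Sum>i<2*t. X ^ 2 ^ i\<close> is idempotent, but it is neither \<open>0\<close> nor \<open>1\<close>.

  \<^item> If \<open>geo u X = P * Q\<close>, then reversing the coefficients either swaps the two factors, or fixes
    \<open>P\<close>, in which case \<open>P\<close> and \<open>Q\<close> are known explicitly (\<open>geo_eq_two_Mersenne\<close>).

  \<^item> \<open>(1 + X) ^ j = 1 + X ^ j\<close> only if \<open>j\<close> is a power of two (\<open>Frobenius_binomial_exponent\<close>).

  What survives is \<open>A = X ^ 4 * (X + 1) ^ 4 * geo 5 X * geo 5 (X + 1)\<close>,
  \<open>A = X ^ 6 * (X + 1) ^ 3 * geo 7 X\<close>, and the polynomial \<open>C1\<close> written in \<open>X\<close>.  The two choices of
  \<open>X\<close> give the five polynomials of the theorem, and their perfectness is a direct computation.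
\<close>

section \<open>Polynomials over the field with two elements\<close>

lemma bit_of_nat: "(of_nat n :: bit) = of_bool (odd n)"
  by (induction n) auto

lemma bit_poly_two [simp]: "(2 :: bit poly) = 0"
  by (simp add: numeral_poly)

lemma bit_poly_add_self [simp]: "(p :: bit poly) + p = 0"
  using mult_2[of p] by simp

lemma bit_poly_add_self_left [simp]: "(p :: bit poly) + (p + q) = q"
  by (simp flip: add.assoc)

lemma bit_poly_uminus [simp]: "- (p :: bit poly) = p"
  by (simp add: minus_unique)

lemma bit_poly_minus [simp]: "(p :: bit poly) - q = p + q"
  by (metis bit_poly_uminus diff_conv_add_uminus)

lemma bit_poly_add_eq_iff: "(p :: bit poly) + q = r \<longleftrightarrow> p = q + r"
  by (metis add.commute bit_poly_add_self_left)

lemma bit_poly_frobenius: "(p + q :: bit poly) ^ (2 ^ n) = p ^ (2 ^ n) + q ^ (2 ^ n)"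
proof (induction n)
  case (Suc n)
  have sq: "(a + b) ^ 2 = a ^ 2 + b ^ 2" for a b :: "bit poly"
    using power2_sum[of a b] by (simp add: mult_2 distrib_right)
  show ?case
    using Suc by (simp only: power_Suc2 power_mult sq)
qed simp

lemma bit_poly_square_add: "(p + q :: bit poly) ^ 2 = p ^ 2 + q ^ 2"
  using bit_poly_frobenius[of p q 1] by simp

lemma bit_poly_degree_0: "degree (p :: bit poly) = 0 \<Longrightarrow> p = 0 \<or> p = 1"
  by (elim degree_eq_zeroE) (use bit.exhaust in \<open>force simp: one_pCons\<close>)

lemma bit_poly_is_unit_iff [simp]: "is_unit (p :: bit poly) \<longleftrightarrow> p = 1"
  using bit_poly_degree_0[of p] is_unit_iff_degree[of p] by (cases "p = 0") auto

lemma bit_poly_normalize [simp]: "normalize (p :: bit poly) = p"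
  using unit_factor_is_unit[of p] normalize_mult_unit_factor[of p] by (cases "p = 0") auto

lemma bit_poly_prime_iff: "prime (p :: bit poly) \<longleftrightarrow> irreducible p"
  by (simp add: prime_def prime_elem_iff_irreducible)

lemma bit_poly_dvd_antisym: "(p :: bit poly) dvd q \<Longrightarrow> q dvd p \<Longrightarrow> p = q"
  using associated_eqI[of p q] by simp

lemma bit_poly_dvd_degree_eq:
  assumes "(p :: bit poly) dvd q" "degree p = degree q" "q \<noteq> 0"
  shows "p = q"
proof -
  obtain r where r: "q = p * r" using assms(1) by blast
  then have "degree r = 0" "r \<noteq> 0" using assms by (auto simp: degree_mult_eq)
  then show ?thesis using r bit_poly_degree_0 by force
qed

lemma irreducible_degree_pos: "irreducible (p :: bit poly) \<Longrightarrow> degree p > 0"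
  using bit_poly_degree_0[of p] by (auto simp: irreducible_def)

lemma irreducible_dvd_irreducible:
  "irreducible (p :: bit poly) \<Longrightarrow> irreducible q \<Longrightarrow> p dvd q \<Longrightarrow> p = q"
  by (simp add: bit_poly_prime_iff[symmetric] primes_dvd_imp_eq)

lemma irreducible_dvd_mult:
  "irreducible (p :: bit poly) \<Longrightarrow> p dvd a * b \<longleftrightarrow> p dvd a \<or> p dvd b"
  by (simp add: bit_poly_prime_iff[symmetric] prime_dvd_mult_iff)

lemma irreducible_dvd_power:
  "irreducible (p :: bit poly) \<Longrightarrow> p dvd a ^ n \<Longrightarrow> p dvd a"
  using prime_dvd_power[of p a n] by (simp add: bit_poly_prime_iff)

lemma dvd_mult_irreducible_cases:
  assumes "irreducible (p :: bit poly)" "irreducible q" "d dvd p * q"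
  shows "d = 1 \<or> d = p \<or> d = q \<or> d = p * q"
proof -
  have *: "d' = 1 \<or> d' = r" if "irreducible r" "d' dvd r" for d' r :: "bit poly"
    using irreducibleD'[OF that] bit_poly_dvd_antisym[OF that(2)] by auto
  obtain a b where "d = a * b" "a dvd p" "b dvd q" using assms(3) division_decomp by blast
  then show ?thesis using *[OF assms(1), of a] *[OF assms(2), of b] by auto
qed

section \<open>Geometric sums\<close>

text \<open>The sum of the divisors of \<open>y ^ (n - 1)\<close> when \<open>y\<close> is irreducible and \<open>n > 0\<close>.\<close>

definition geo :: "nat \<Rightarrow> bit poly \<Rightarrow> bit poly" where
  "geo n y = (\<Sum>i<n. y ^ i)"

lemma geo_0 [simp]: "geo 0 y = 0" by (simp add: geo_def)
lemma geo_1 [simp]: "geo (Suc 0) y = 1" by (simp add: geo_def)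
lemma geo_Suc: "geo (Suc n) y = geo n y + y ^ n" by (simp add: geo_def)
lemma geo_Suc_shift: "geo (Suc n) y = 1 + y * geo n y"
  unfolding geo_def sum.lessThan_Suc_shift by (simp add: sum_distrib_left)

lemma geo_mult: "(1 + y) * geo n y = 1 + y ^ n"
  using power_diff_1_eq[of y n] by (simp add: geo_def add.commute)

lemma geo_mult_index: "geo (m * n) y = geo m y * geo n (y ^ m)"
  unfolding geo_def using sum.nat_group[of "\<lambda>i. y ^ i" m n]
proof (induction n)
  case (Suc n)
  have "(\<Sum>i<m * Suc n. y ^ i) = (\<Sum>i<m * n. y ^ i) + (\<Sum>i=m*n..<m*n+m. y ^ i)"
    by (metis add.commute le_add2 lessThan_atLeast0 mult_Suc_right sum.atLeastLessThan_concat zero_le)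
  also have "(\<Sum>i=m*n..<m*n+m. y ^ i) = (\<Sum>i<m. y ^ i) * (y ^ m) ^ n"
    using sum.shift_bounds_nat_ivl[of "\<lambda>i. y ^ i" 0 "m*n" m]
    by (simp add: power_add power_mult sum_distrib_right add.commute lessThan_atLeast0)
  finally show ?case using Suc.IH sum.nat_group[of "\<lambda>i. y ^ i" m n] by (simp add: distrib_left)
qed simp

lemma geo_pow2: "geo (2 ^ n) y = (1 + y) ^ (2 ^ n - 1)"
proof (induction n)
  case (Suc n)
  have "geo (2 ^ Suc n) y = geo (2 ^ n) y * geo 2 (y ^ 2 ^ n)"
    using geo_mult_index[of "2 ^ n" 2 y] by (simp add: mult.commute)
  moreover have "geo 2 z = 1 + z" for z by (simp add: numeral_2_eq_2 geo_Suc)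
  ultimately have "geo (2 ^ Suc n) y = (1 + y) ^ (2 ^ n - 1 + 2 ^ n)"
    by (simp only: Suc.IH power_add bit_poly_frobenius power_one)
  also have "(2 ^ n - 1 + 2 ^ n :: nat) = 2 ^ Suc n - 1" by simp
  finally show ?case .
qed simp

lemma geo_power: "geo m (y ^ 2 ^ n) = geo m y ^ 2 ^ n"
proof (induction m)
  case (Suc m)
  then show ?case
    by (simp add: geo_Suc bit_poly_frobenius flip: power_mult) (simp add: mult.commute)
qed (simp add: geo_def)

text \<open>In characteristic two the even part of the index splits off, by the Frobenius endomorphism.\<close>

lemma geo_pow2_mult: "geo (2 ^ n * m) y = (1 + y) ^ (2 ^ n - 1) * geo m y ^ 2 ^ n"
  by (simp add: geo_mult_index geo_pow2 geo_power)

lemma odd_part: assumes "n > (0::nat)" obtains t m where "n = 2 ^ t * m" "odd m"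
  by (metis assms multiplicity_decompose' neq0_conv odd_one order_less_irrefl)

text \<open>Apart from the single factor \<open>y\<close> and powers of \<open>1 + y\<close>, the polynomial \<open>geo u y + 1\<close> is a
  \<open>2 ^ t\<close>-th power.  This is the source of every parity contradiction below.\<close>

lemma geo_odd_minus_1:
  assumes "odd u" "u > 1"
  obtains t m where "t > 0" "odd m" "u = 2 ^ t * m + 1"
    "geo u y + 1 = y * (1 + y) ^ (2 ^ t - 1) * geo m y ^ 2 ^ t"
proof -
  obtain t m where tm: "u - 1 = 2 ^ t * m" "odd m" using odd_part[of "u - 1"] assms by auto
  have "t > 0" using tm assms by (cases t) auto
  moreover have u: "u = Suc (2 ^ t * m)" using tm assms by auto
  moreover have "geo u y + 1 = y * (1 + y) ^ (2 ^ t - 1) * geo m y ^ 2 ^ t"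
    unfolding u geo_Suc_shift geo_pow2_mult by (simp add: add.commute mult.assoc)
  ultimately show ?thesis using that tm by simp
qed

lemma poly_geo:
  "poly (geo n y) z = (if poly y z = 0 then of_bool (n > 0) else of_bool (odd n))"
proof (induction n)
  case (Suc n)
  then show ?case by (cases "poly y z"; cases "even n"; cases n) (simp_all add: geo_Suc)
qed simp

lemma degree_geo_Suc: "degree (geo (Suc n) y) = n * degree y" if "degree y > 0"
proof (induction n)
  case (Suc n)
  have "geo (Suc (Suc n)) y = 1 + y * geo (Suc n) y" by (rule geo_Suc_shift)
  moreover have "geo (Suc n) y \<noteq> 0"
  proof
    assume "geo (Suc n) y = 0"
    then have "1 + y ^ Suc n = 0" by (metis geo_mult mult_zero_right)
    then have "y ^ Suc n = 1" by (simp add: bit_poly_add_eq_iff)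
    then have "degree (y ^ Suc n) = 0" by simp
    then show False using that degree_power_eq[of y "Suc n"] by (cases "y = 0") auto
  qed
  moreover have "y \<noteq> 0" using that by auto
  ultimately show ?case using Suc that by (simp add: degree_add_eq_right degree_mult_eq)
qed simp

lemma degree_geo: "n > 0 \<Longrightarrow> degree y > 0 \<Longrightarrow> degree (geo n y) = (n - 1) * degree y"
  using degree_geo_Suc[of y "n - 1"] by simp

lemma geo_eq_1_iff: "degree y > 0 \<Longrightarrow> n > 0 \<Longrightarrow> geo n y = 1 \<longleftrightarrow> n = 1"
  using degree_geo[of n y] by (cases "n = 1") auto

lemma geo_nonzero: "n > 0 \<Longrightarrow> degree y > 0 \<Longrightarrow> geo n y \<noteq> 0"
  using degree_geo[of n y] by (cases "n = 1") auto

section \<open>Geometric sums at primes\<close>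

lemma irreducible_coprime: "irreducible (p :: bit poly) \<Longrightarrow> \<not> p dvd q \<Longrightarrow> coprime p q"
  by (simp add: bit_poly_prime_iff[symmetric] prime_imp_coprime)

lemma coprime_dvd_eq_1: "coprime (p :: bit poly) q \<Longrightarrow> p dvd q \<Longrightarrow> p = 1"
  using coprime_common_divisor[of p q p] by simp

lemma degree_1_irreducible: "degree (p :: bit poly) = 1 \<Longrightarrow> irreducible p"
  by (elim degree1_coeffs) (simp add: irreducible_linear_field_poly)

text \<open>Divisibility by a linear polynomial is evaluation at a point, and at that point the other linear
  polynomial has the value \<open>1\<close>.\<close>

lemma linear_root:
  assumes "X = pX \<or> X = pX + 1"
  obtains z where "poly X z = 0" "poly (X + 1) z = 1" "\<And>f. X dvd f \<longleftrightarrow> poly f z = 0"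
proof (cases "X = pX")
  case True
  then show ?thesis using that[of 0] by (simp add: dvd_iff_poly_eq_0[of 0, simplified])
next
  case False
  then have X: "X = [:1, 1:]" using assms by (simp add: one_pCons)
  have "- (1 :: bit) = 1" by (simp add: uminus_bit_def)
  then show ?thesis using that[of 1] X poly_eq_0_iff_dvd[of _ "1 :: bit"] by (simp add: one_pCons)
qed

lemma power_dvd_pderiv:
  assumes "R ^ Suc k dvd (f :: bit poly)"
  shows "R ^ k dvd pderiv f"
proof -
  obtain T where "f = R ^ Suc k * T" using assms by blast
  then have "pderiv f = R ^ Suc k * pderiv T + T * (smult (of_nat (Suc k)) (R ^ k) * pderiv R)"
    by (simp only: pderiv_mult pderiv_power_Suc)
  also have "R ^ k dvd \<dots>"
    by (intro dvd_add dvd_mult dvd_mult2 dvd_smult) (simp_all only: power_Suc dvd_triv_right dvd_refl)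
  finally show ?thesis .
qed

lemma degree_pderiv_less: "degree (p :: bit poly) > 0 \<Longrightarrow> degree (pderiv p) < degree p"
  by (rule le_less_trans[of _ "degree p - 1"], rule degree_le) (auto simp: coeff_pderiv coeff_eq_0)

lemma pderiv_one_plus_power:
  "odd w \<Longrightarrow> pderiv (1 + y ^ w :: bit poly) = y ^ (w - 1) * pderiv y"
  by (simp add: pderiv_add pderiv_power bit_of_nat)

text \<open>Because \<open>1 + X ^ u\<close> and its derivative \<open>X ^ (u - 1)\<close> are coprime.\<close>

lemma geo_squarefree:
  assumes "odd u" "pderiv X = 1" "irreducible R" "R ^ 2 dvd geo u X"
  shows False
proof -
  have "R ^ Suc 1 dvd 1 + X ^ u"
    using assms(4) geo_mult[of X u] by (metis Suc_1 dvd_mult)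
  then have "R dvd X ^ (u - 1)"
    using power_dvd_pderiv[of R 1 "1 + X ^ u"] pderiv_one_plus_power[OF assms(1), of X] assms(2) by simp
  then have "R dvd X" using assms(3) irreducible_dvd_power by blast
  then have "R dvd X ^ u" using assms(1) by (metis dvd_power dvd_trans even_zero gr0I)
  moreover have "R dvd 1 + X ^ u" using \<open>R ^ Suc 1 dvd _\<close> by (metis Suc_1 dvd_trans dvd_triv_left power2_eq_square)
  ultimately have "R dvd 1" by (metis dvd_add_left_iff)
  then show False using assms(3) by (auto simp: irreducible_def)
qed

text \<open>The field with two elements is perfect: the even part of a polynomial is a square.  The derivative
  of the right-hand side is \<open>s ^ 2\<close>, so a polynomial with vanishing derivative is a square.\<close>

lemma bit_poly_even_odd_parts: "\<exists>r s. (p :: bit poly) = r ^ 2 + pX * s ^ 2"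
proof (induction p)
  case (pCons a p)
  then obtain r s where "p = r ^ 2 + pX * s ^ 2" by blast
  then have "pCons a p = [:a:] + pX * r ^ 2 + pX ^ 2 * s ^ 2"
    by (simp add: algebra_simps power2_eq_square)
  also have "[:a:] = [:a:] ^ 2" by (cases a) (auto simp: power2_eq_square)
  finally have "pCons a p = ([:a:] + pX * s) ^ 2 + pX * r ^ 2"
    by (simp only: bit_poly_square_add power_mult_distrib add_ac)
  then show ?case by blast
qed (auto intro!: exI[of _ 0])

lemma irreducible_pderiv_nonzero:
  assumes "irreducible (p :: bit poly)"
  shows "pderiv p \<noteq> 0"
proof
  assume 0: "pderiv p = 0"
  obtain r s where p: "p = r ^ 2 + pX * s ^ 2" using bit_poly_even_odd_parts by blast
  have "pderiv p = s ^ 2"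
    by (simp add: p pderiv_add pderiv_mult power2_eq_square pderiv_pCons mult.commute)
  with 0 p have "p = r * r" by (simp add: power2_eq_square)
  then have "r = 1" using assms irreducibleD by fastforce
  then show False using assms \<open>p = r * r\<close> by (auto simp: irreducible_def)
qed

text \<open>If \<open>k \<ge> 2\<close>, then \<open>Q ^ (k - 1)\<close> divides the derivative \<open>P ^ (w - 1) * pderiv P\<close> of
  \<open>1 + P ^ w\<close>, hence divides \<open>pderiv P\<close>; but its degree is at least half of
  \<open>k * degree Q = (w - 1) * degree P\<close>, so at least the degree of \<open>P\<close>.\<close>

lemma geo_eq_prime_power:
  assumes "irreducible P" "irreducible Q" "odd w" "geo w P = Q ^ k"
  shows "k \<le> 1"
proof (rule ccontr)
  assume "\<not> k \<le> 1"
  then have k: "k \<ge> 2" by simp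
  have dP: "degree P > 0" and dQ: "degree Q > 0" using assms irreducible_degree_pos by auto
  have w0: "w > 0" using assms(3) by (rule odd_pos)
  have deg: "k * degree Q = (w - 1) * degree P"
    using degree_geo[OF w0 dP] assms by (simp add: degree_power_eq irreducible_def)
  then have w: "w \<ge> 3" using assms(3) dQ k by (cases "w = 1") (auto, presburger)
  have "Q ^ Suc (k - 1) dvd 1 + P ^ w"
    using k geo_mult[of P w] assms(4) by (metis dvd_triv_right Suc_pred' less_le_trans zero_less_numeral)
  then have 1: "Q ^ (k - 1) dvd P ^ (w - 1) * pderiv P"
    using power_dvd_pderiv pderiv_one_plus_power[OF assms(3)] by metis
  have "\<not> Q dvd P"
  proof
    assume "Q dvd P"
    then have "Q = P" using assms irreducible_dvd_irreducible by blast
    then have "P dvd geo w P" using assms(4) k by (simp add: dvd_power)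
    then have "P dvd 1" using geo_Suc_shift[of "w - 1" P] w by (simp add: dvd_add_left_iff)
    then show False using dP by auto
  qed
  then have "coprime (Q ^ (k - 1)) (P ^ (w - 1))" using assms(2) irreducible_coprime by simp
  then have "Q ^ (k - 1) dvd pderiv P" using 1 by (simp add: coprime_dvd_mult_right_iff)
  then have "(k - 1) * degree Q \<le> degree (pderiv P)"
    using dvd_imp_degree_le[of "Q ^ (k - 1)" "pderiv P"] irreducible_pderiv_nonzero[OF assms(1)] assms(2)
    by (simp add: degree_power_eq irreducible_def)
  also have "\<dots> < degree P" using dP by (rule degree_pderiv_less)
  finally have "2 * (k - 1) * degree Q < 2 * degree P" by simp
  moreover have "k * degree Q \<le> 2 * (k - 1) * degree Q" using k by (intro mult_right_mono) auto
  moreover have "2 * degree P \<le> (w - 1) * degree P" using w by (intro mult_right_mono) auto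
  ultimately show False using deg by linarith
qed

text \<open>With \<open>m\<close> the odd part of \<open>j\<close>, the polynomial \<open>geo m X\<close> divides \<open>1 + X ^ j = (1 + X) ^ j\<close> but is
  coprime to \<open>1 + X\<close>.\<close>

lemma Frobenius_binomial_exponent:
  assumes "X = pX \<or> X = pX + 1" "j > 0" "(1 + X) ^ j = 1 + X ^ j"
  obtains e where "j = 2 ^ e"
proof -
  obtain e m where em: "j = 2 ^ e * m" "odd m" using odd_part assms(2) by blast
  have m: "m > 0" using em by (auto intro: odd_pos)
  have dX: "degree X = 1" and d1X: "degree (1 + X) = 1" and "1 + X = pX \<or> 1 + X = pX + 1"
    using assms(1) by (auto simp: one_pCons)
  then obtain z where z: "poly (1 + X) z = 0" "poly (1 + X + 1) z = 1" "\<And>f. 1 + X dvd f \<longleftrightarrow> poly f z = 0"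
    using linear_root by blast
  have "(1 + X) ^ j = (1 + X) * ((1 + X) ^ (2 ^ e - 1) * geo m X ^ 2 ^ e)"
    using assms(3) geo_mult[of X j] by (simp add: em geo_pow2_mult)
  then have "geo m X dvd (1 + X) ^ j" by (simp add: dvd_power)
  moreover have "\<not> 1 + X dvd geo m X"
    using z em poly_geo[of m X z] by (simp add: add.commute)
  then have "coprime (geo m X) ((1 + X) ^ j)"
    using irreducible_coprime[OF degree_1_irreducible[OF d1X], of "geo m X"] by (simp add: coprime_commute)
  ultimately have "geo m X = 1" using coprime_dvd_eq_1 by blast
  then have "m = 1" using geo_eq_1_iff dX m by simp
  then show ?thesis using em that by simp
qed

lemma coeff_pX_power: "coeff (pX ^ n) m = (if n = m then 1 else 0)"
  using monom_altdef[of "1::bit" n] by (metis coeff_monom smult_1_left)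

lemma coeff_geo_pX: "coeff (geo n pX) m = of_bool (m < n)"
  by (simp add: geo_def coeff_sum coeff_pX_power)

text \<open>Put \<open>p = 2 ^ t + 1\<close>.  The powers \<open>2 ^ i\<close>, \<open>i < 2 * t\<close>, form the subgroup generated by \<open>2\<close> modulo \<open>p\<close>,
  so the sum \<open>e\<close> of the monomials \<open>x ^ 2 ^ i\<close> satisfies \<open>e ^ 2 = e\<close> modulo \<open>x ^ p + 1\<close>.  An irreducible
  divisor \<open>P = geo p x\<close> of \<open>x ^ p + 1\<close> thus divides \<open>e\<close> or \<open>e + 1\<close>.  After reducing exponents modulo
  \<open>p\<close>, these are nonzero and have degree at most \<open>p - 1 = degree P\<close>, so one of them equals \<open>P\<close>, in
  which all \<open>p\<close> coefficients are \<open>1\<close>.  For \<open>t \<ge> 3\<close> both have a vanishing coefficient.\<close>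

lemma geo_Fermat_irreducible_pX:
  assumes "irreducible (geo (2 ^ t + 1) pX)"
  shows "t \<le> 2"
proof (rule ccontr)
  assume "\<not> t \<le> 2"
  then have t: "t \<ge> 3" by simp
  define p :: nat where "p = 2 ^ t + 1"
  define P where "P = geo p pX"
  have irr: "irreducible P" using assms by (simp add: P_def p_def)
  have degP: "degree P = p - 1" using degree_geo[of p pX] by (simp add: P_def p_def)
  have P_dvd: "P dvd 1 + pX ^ (p * m)" for m
  proof -
    have "P dvd 1 + pX ^ p" using geo_mult[of pX p] by (metis P_def dvd_triv_right)
    also have "\<dots> dvd 1 + (pX ^ p) ^ m" using geo_mult[of "pX ^ p" m] by (metis dvd_triv_left)
    finally show ?thesis by (simp add: power_mult)
  qed
  define e where "e n = (\<Sum>i<n. pX ^ 2 ^ i)" for n :: nat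
  have e2: "e n * (e n + 1) = pX ^ 2 ^ n + pX" for n
  proof (induction n)
    case (Suc n)
    have "e (Suc n) * (e (Suc n) + 1) = e n * (e n + 1) + pX ^ 2 ^ n + (pX ^ 2 ^ n)\<^sup>2"
      by (simp add: e_def algebra_simps power2_eq_square flip: mult_2)
    also have "\<dots> = pX ^ 2 ^ Suc n + pX"
      by (simp only: Suc.IH power_Suc2 power_mult) (simp add: algebra_simps)
    finally show ?case .
  qed (simp add: e_def)
  have half: "2 * 2 ^ i \<le> (2::nat) ^ t" if "i < t" for i
    using power_increasing[of "Suc i" t "2::nat"] that by simp
  then have le: "2 ^ i \<le> (2::nat) ^ t" if "i < t" for i using that by fastforce
  have t8: "(2::nat) ^ t \<ge> 8" using power_increasing[OF t, of "2::nat"] by simp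
  have "pX ^ 2 ^ (2 * t) + pX = pX * (1 + pX ^ (p * (2 ^ t - 1)))"
  proof -
    have "p * (2 ^ t - 1) = 2 ^ (2 * t) - 1"
      by (simp add: p_def power_mult power2_eq_square algebra_simps power_mult[symmetric] flip: power_add)
    then show ?thesis by (simp add: distrib_left flip: power_Suc)
  qed
  then have "P dvd e (2 * t) * (e (2 * t) + 1)" unfolding e2 using P_dvd dvd_mult by metis
  then have P_e: "P dvd e (2 * t) \<or> P dvd e (2 * t) + 1" using irr irreducible_dvd_mult by blast
  \<comment> \<open>Reduction modulo \<open>x ^ p + 1\<close>: \<open>2 ^ (t + i)\<close> is congruent to \<open>- (2 ^ i)\<close> modulo \<open>p\<close>.\<close>
  define e' where "e' = (\<Sum>i<t. pX ^ 2 ^ i + pX ^ (p - 2 ^ i))"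
  have "P dvd e (2 * t) + e'"
  proof -
    have "e (t + n) = e t + (\<Sum>i<n. pX ^ 2 ^ (t + i))" for n
      by (induction n) (simp_all add: e_def add.assoc)
    then have "e (2 * t) = e t + (\<Sum>i<t. pX ^ 2 ^ (t + i))" by (simp add: mult_2)
    then have "e (2 * t) + e' = (\<Sum>i<t. pX ^ 2 ^ (t + i) + pX ^ (p - 2 ^ i))"
      by (simp add: e'_def e_def sum.distrib algebra_simps)
    moreover have "P dvd pX ^ 2 ^ (t + i) + pX ^ (p - 2 ^ i)" if "i < t" for i
    proof -
      have "2 ^ (t + i) = (p - 2 ^ i) + p * (2 ^ i - 1)"
      proof -
        obtain x where x: "(2::nat) ^ i = Suc x" using not0_implies_Suc[of "2 ^ i"] by auto
        then show ?thesis using le[OF that] by (simp add: p_def power_add)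
      qed
      then have "pX ^ 2 ^ (t + i) + pX ^ (p - 2 ^ i) = pX ^ (p - 2 ^ i) * (1 + pX ^ (p * (2 ^ i - 1)))"
        by (simp only: power_add distrib_left mult_1_right add.commute)
      then show ?thesis using P_dvd by simp
    qed
    ultimately show ?thesis by (simp only:) (rule dvd_sum, simp)
  qed
  then have P_e': "P dvd e' \<or> P dvd e' + 1"
    using P_e dvd_add_right_iff[of P "e (2 * t) + e'" "e (2 * t)"]
      dvd_add_right_iff[of P "e (2 * t) + e'" "e (2 * t) + 1"]
    by (simp add: ac_simps dvd_add_left_iff)
  have ce': "coeff e' n = (\<Sum>i<t. of_bool (2 ^ i = n) + of_bool (p - 2 ^ i = n))" for n
    by (simp add: e'_def coeff_sum coeff_pX_power of_bool_def)
  have "Suc (2 ^ t) - 2 ^ i \<le> 2 ^ t" for i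
    using one_le_power[of "2::nat" i] by linarith
  then have "degree e' \<le> p - 1"
    unfolding e'_def using le by (intro degree_sum_le degree_add_le) (auto simp: degree_power_eq p_def)
  then have deg: "f = P" if "P dvd f" "f \<noteq> 0" "f = e' \<or> f = e' + 1" for f
    using that dvd_imp_degree_le[of P f] degP bit_poly_dvd_degree_eq[of P f] degree_add_le[of e' "p - 1" 1]
    by force
  have c0: "coeff e' 0 = 0"
    unfolding ce'
  proof (rule sum.neutral, rule ballI)
    fix i assume "i \<in> {..<t}"
    then have "2 ^ i \<le> (2::nat) ^ t" using le by blast
    then have "p - 2 ^ i \<noteq> 0" unfolding p_def by linarith
    then show "of_bool ((2::nat) ^ i = 0) + of_bool (p - 2 ^ i = 0) = (0::bit)" by simp
  qed
  have c1: "coeff e' 1 = 1"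
  proof -
    have "coeff e' 1 = (\<Sum>i<t. if i = 0 then 1 else 0)"
      unfolding ce'
    proof (rule sum.cong)
      fix i assume "i \<in> {..<t}"
      then show "of_bool ((2::nat) ^ i = 1) + of_bool (p - 2 ^ i = 1) = (if i = 0 then 1 else (0::bit))"
        using half[of i] t8 by (auto simp: p_def)
    qed simp
    then show ?thesis using t by simp
  qed
  \<comment> \<open>Here \<open>t \<ge> 3\<close> is essential: \<open>p - 2 ^ i = 3\<close> has the solution \<open>i = 1\<close> for \<open>t = 2\<close>.\<close>
  have c3: "coeff e' 3 = 0"
    unfolding ce'
  proof (rule sum.neutral, rule ballI)
    fix i assume "i \<in> {..<t}"
    moreover have "(2::nat) ^ i \<noteq> 3"
    proof
      assume 3: "(2::nat) ^ i = 3"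
      have "odd ((2::nat) ^ i)" unfolding 3 by simp
      then have "i = 0" by simp
      then show False using 3 by simp
    qed
    ultimately show "of_bool ((2::nat) ^ i = 3) + of_bool (p - 2 ^ i = 3) = (0::bit)"
      using half[of i] t8 by (auto simp: p_def)
  qed
  show False using P_e'
  proof
    assume "P dvd e'"
    moreover have "e' \<noteq> 0" using c1 by auto
    ultimately have "e' = P" using deg by blast
    then show False using c0 by (simp add: P_def coeff_geo_pX p_def)
  next
    assume "P dvd e' + 1"
    moreover have "coeff (e' + 1) 0 = 1" using c0 by simp
    then have "e' + 1 \<noteq> 0" by (metis coeff_0 zero_neq_one)
    ultimately have "e' + 1 = P" using deg by blast
    then have "coeff (e' + 1) 3 = 1"
      using t8 by (simp add: P_def coeff_geo_pX p_def)
    then show False using c3 by simp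
  qed
qed

section \<open>Reversal of coefficients\<close>

text \<open>As for the numbers \<open>y ^ u - 1\<close>: reduce the index \<open>u\<close> modulo \<open>r\<close> and compare degrees.\<close>

lemma geo_dvd_geo_iff:
  assumes "degree y > 0" "r > 0"
  shows "geo r y dvd geo u y \<longleftrightarrow> r dvd u"
proof
  assume "r dvd u"
  then show "geo r y dvd geo u y" by (auto simp: geo_mult_index)
next
  assume dvd: "geo r y dvd geo u y"
  have split: "geo (m + n) y = geo m y + y ^ m * geo n y" for m n
    by (induction n) (simp_all add: geo_Suc power_add algebra_simps)
  have u: "geo u y = geo r y * geo (u div r) (y ^ r) + y ^ (r * (u div r)) * geo (u mod r) y"
    by (simp flip: geo_mult_index split)
  have "coprime (geo r y) (y ^ n)" for n
  proof -
    have "geo r y = 1 + y * geo (r - 1) y" using geo_Suc_shift[of "r - 1"] assms by simp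
    then have "coprime (geo r y) y"
      by (metis coprime_1_left coprime_commute coprime_iff_gcd_eq_1 gcd_add_mult gcd.commute mult.commute add.commute)
    then show ?thesis by (simp add: coprime_power_right_iff)
  qed
  then have *: "geo r y dvd geo (u mod r) y"
    using dvd unfolding u by (metis coprime_dvd_mult_right_iff dvd_add_right_iff dvd_triv_left)
  show "r dvd u"
  proof (rule ccontr)
    assume "\<not> r dvd u"
    then have "0 < u mod r" by (simp add: dvd_eq_mod_eq_0)
    moreover have "u mod r < r" using assms by simp
    ultimately have "degree (geo r y) \<le> degree (geo (u mod r) y)"
      using * geo_nonzero assms by (intro dvd_imp_degree_le) auto
    then have "r - 1 \<le> u mod r - 1" using \<open>0 < u mod r\<close> assms by (simp add: degree_geo)
    then show False using \<open>0 < u mod r\<close> \<open>u mod r < r\<close> by linarith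
  qed
qed

lemma reflect_geo_pX: "reflect_poly (geo n pX) = geo n pX"
proof (cases "n = 0")
  case False
  then have "degree (geo n pX) = n - 1" using degree_geo[of n pX] by simp
  then show ?thesis using False by (intro poly_eqI) (auto simp: coeff_reflect_poly coeff_geo_pX)
qed simp

lemma reflect_Mersenne:
  assumes "i > 0" "j > 0" "P + 1 = pX ^ i * (pX + 1) ^ j"
  shows "reflect_poly P = pX ^ (i + j) + (pX + 1) ^ j"
proof -
  define M where "M = pX ^ i * (pX + 1) ^ j"
  have P: "P = M + 1" using assms(3) by (simp add: M_def bit_poly_add_eq_iff add.commute)
  have degM: "degree M = i + j" by (simp add: M_def degree_mult_eq degree_power_eq one_pCons)
  then have degP: "degree P = i + j" using assms by (simp add: P degree_add_eq_left)
  have "reflect_poly pX = 1" by (simp add: reflect_poly_def one_pCons)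
  moreover have "reflect_poly (pX + 1) = pX + 1" by (simp add: reflect_poly_def one_pCons)
  ultimately have M': "reflect_poly M = (pX + 1) ^ j"
    unfolding M_def by (simp only: reflect_poly_mult reflect_poly_power) simp
  have "coeff P m = coeff M m + of_bool (m = 0)" for m by (simp add: P)
  then have "coeff (reflect_poly P) n = coeff (pX ^ (i + j)) n + coeff (reflect_poly M) n" for n
    by (auto simp: coeff_reflect_poly degP degM coeff_pX_power)
  then show ?thesis by (intro poly_eqI) (simp add: M')
qed

text \<open>Self-reciprocity means \<open>x ^ i * (x + 1) ^ j + 1 = x ^ (i + j) + (x + 1) ^ j\<close>.  If \<open>i \<ge> 2\<close>, the values
  of the derivatives at \<open>0\<close> and \<open>1\<close> make \<open>j\<close> and \<open>i + j\<close> even, and \<open>P\<close> would be a square.  For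
  \<open>i = 1\<close> the equation is \<open>(1 + x) ^ (j + 1) = 1 + x ^ (j + 1)\<close>.\<close>

lemma self_reciprocal_Mersenne:
  assumes "irreducible P" "i > 0" "j > 0" "P + 1 = pX ^ i * (pX + 1) ^ j" "reflect_poly P = P"
  obtains f where "f > 0" "i = 1" "j = 2 ^ f - 1" "P = geo (2 ^ f + 1) pX"
proof -
  have P: "P = pX ^ i * (pX + 1) ^ j + 1"
    using assms(4) by (simp add: bit_poly_add_eq_iff add.commute)
  have eq: "pX ^ i * (pX + 1) ^ j + 1 = pX ^ (i + j) + (pX + 1) ^ j"
    using reflect_Mersenne[OF assms(2-4)] assms(5) P by simp
  have i1: "i = 1"
  proof (rule ccontr)
    assume "i \<noteq> 1"
    have d: "poly (pderiv (pX ^ i * (pX + 1) ^ j + 1)) z = poly (pderiv (pX ^ (i + j) + (pX + 1) ^ j)) z" for z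
      by (simp only: eq)
    have "even j" using d[of 0] \<open>i \<noteq> 1\<close> assms(2,3)
      by (simp add: pderiv_mult pderiv_add pderiv_power pderiv_pCons poly_power bit_of_nat power_0_left split: if_splits)
    moreover have "even (i + j)" using d[of 1] \<open>i \<noteq> 1\<close> assms(2,3) \<open>even j\<close>
      by (simp add: pderiv_mult pderiv_add pderiv_power pderiv_pCons poly_power bit_of_nat power_0_left split: if_splits)
    ultimately have "pderiv P = 0"
      unfolding P by (simp add: pderiv_mult pderiv_add pderiv_power bit_of_nat)
    then show False using irreducible_pderiv_nonzero assms(1) by blast
  qed
  have "(1 + pX) ^ (j + 1) = 1 + pX ^ (j + 1)"
    using eq unfolding i1 by (simp add: algebra_simps bit_poly_add_eq_iff)
  then obtain f where f: "j + 1 = 2 ^ f" using Frobenius_binomial_exponent[of pX "j + 1"] by auto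
  have "f > 0" using f assms(3) by (cases f) auto
  moreover have j: "j = 2 ^ f - 1" using f by simp
  moreover have "P = geo (2 ^ f + 1) pX"
    using geo_Suc_shift[of "2 ^ f" pX] P unfolding geo_pow2 j i1 by (simp add: add.commute)
  ultimately show ?thesis using that i1 by blast
qed

text \<open>Reversal fixes \<open>geo u x = P * Q\<close>, so it sends \<open>P\<close> to \<open>Q\<close> or to itself.  In the second case
  \<open>P = geo r x\<close> with \<open>r = 2 ^ f + 1\<close>, hence \<open>u = r * u'\<close> and \<open>Q = geo u' (x ^ r)\<close>.  Since
  \<open>geo u' x\<close> also divides \<open>P * Q\<close>, degrees leave only \<open>u' = r\<close>.\<close>

lemma geo_eq_two_Mersenne_pX:
  assumes irr: "irreducible P" "irreducible Q" and u: "geo u pX = P * Q" "u > 0"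
    and M: "i > 0" "j > 0" "P + 1 = pX ^ i * (pX + 1) ^ j"
  shows "Q = pX ^ (i + j) + (pX + 1) ^ j \<or>
    (\<exists>f>0. i = 1 \<and> j = 2 ^ f - 1 \<and> P = geo (2 ^ f + 1) pX \<and>
       Q + 1 = pX ^ (2 ^ f + 1) * (pX + 1) ^ (2 ^ f - 1) * P ^ (2 ^ f - 1))"
proof -
  have 0: "coeff P 0 \<noteq> 0" "coeff Q 0 \<noteq> 0"
    using poly_geo[of u pX 0] u by (auto simp flip: poly_0_coeff_0)
  have nz: "P \<noteq> 0" "Q \<noteq> 0" using 0 by auto
  have PQ: "reflect_poly P * reflect_poly Q = P * Q"
    using reflect_geo_pX[of u] by (simp only: u reflect_poly_mult)
  then consider "P dvd reflect_poly P" | "P dvd reflect_poly Q"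
    using irr irreducible_dvd_mult[of P] by (metis dvd_triv_left)
  then show ?thesis
  proof cases
    case 1
    then have "reflect_poly P = P" using 0 nz bit_poly_dvd_degree_eq[of P "reflect_poly P"] by simp
    then obtain f where f: "f > 0" "i = 1" "j = 2 ^ f - 1" "P = geo (2 ^ f + 1) pX"
      using self_reciprocal_Mersenne[OF irr(1) M] by blast
    define r :: nat where "r = 2 ^ f + 1"
    have r: "r > 1" "P = geo r pX" by (simp_all add: r_def f)
    have "r dvd u" using geo_dvd_geo_iff[of pX r u] u r by simp
    then obtain u' where u': "u = r * u'" by blast
    have "u' > 0" using u' u by (cases u') auto
    have Q: "Q = geo u' (pX ^ r)" using u u' r nz by (simp add: geo_mult_index)
    then have degQ: "degree Q = (u' - 1) * r"
      using r \<open>u' > 0\<close> by (simp add: degree_geo degree_power_eq)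
    have degu': "degree (geo u' pX) = u' - 1" using degree_geo \<open>u' > 0\<close> by simp
    have "u' \<noteq> 1" using Q irr by (auto simp: irreducible_def)
    have "geo u' pX dvd P * Q" using geo_dvd_geo_iff[of pX u' u] u u' \<open>u' > 0\<close> by simp
    then consider "geo u' pX = 1" | "geo u' pX = P" | "geo u' pX = Q" | "geo u' pX = geo u pX"
      using dvd_mult_irreducible_cases[OF irr] u by auto
    then have "u' = r"
    proof cases
      case 2
      have "degree P = r - 1" using degree_geo r by simp
      then show ?thesis using 2 degu' r \<open>u' > 0\<close> by auto
    next
      case 4
      then have "u' - 1 = u - 1" using degu' degree_geo[of u pX] u by simp
      then have "u' = u" using u \<open>u' > 0\<close> by linarith
      then show ?thesis using u' r \<open>u' > 0\<close> by auto
    qed (use degu' degQ r \<open>u' > 0\<close> \<open>u' \<noteq> 1\<close> in auto)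
    then have "Q = 1 + pX ^ r * (1 + pX ^ r) ^ (2 ^ f - 1)"
      using Q geo_Suc_shift[of "2 ^ f" "pX ^ r"] by (simp add: r_def geo_pow2)
    moreover have "1 + pX ^ r = (pX + 1) * P" using geo_mult[of pX r] r by (simp add: add.commute)
    ultimately have "Q + 1 = pX ^ r * (pX + 1) ^ (2 ^ f - 1) * P ^ (2 ^ f - 1)"
      by (simp add: power_mult_distrib mult.assoc add.commute)
    then show ?thesis using f by (auto simp: r_def)
  next
    case 2
    then obtain T where T: "reflect_poly Q = P * T" by blast
    then have "P * (T * reflect_poly P) = P * Q" using PQ by (simp add: ac_simps)
    then have "Q = T * reflect_poly P" using nz by (simp only: mult_cancel_left) simp
    moreover have "reflect_poly P \<noteq> 1"
      using irreducible_degree_pos[OF irr(1)] 0 by (metis degree_1 degree_reflect_poly_eq less_irrefl)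
    ultimately have "T = 1" using irreducibleD[OF irr(2)] by auto
    then show ?thesis using \<open>Q = T * _\<close> reflect_Mersenne[OF M] by simp
  qed
qed

section \<open>The substitution of x + 1 for x\<close>

abbreviation shift :: "bit poly \<Rightarrow> bit poly" where
  "shift p \<equiv> p \<circ>\<^sub>p (pX + 1)"

lemma bit_poly_pcompose_power: "(p ^ n) \<circ>\<^sub>p q = (p \<circ>\<^sub>p q :: bit poly) ^ n"
  by (induction n) (simp_all add: pcompose_mult pcompose_1)

lemma shift_pX [simp]: "shift pX = pX + 1"
  by (simp add: pcompose_pCons)

lemma shift_1 [simp]: "shift 1 = 1"
  by (simp add: one_pCons)

lemma shift_shift [simp]: "shift (shift p) = p"
proof -
  have "shift (pX + 1) = pX" by (simp add: pcompose_add add.assoc del: add_pCons)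
  then show ?thesis by (simp flip: pcompose_assoc)
qed

lemma shift_eq_iff: "shift p = q \<longleftrightarrow> p = shift q"
  by (metis shift_shift)

lemma shift_inj [simp]: "shift p = shift q \<longleftrightarrow> p = q"
  by (metis shift_shift)

lemma shift_simps: "shift (p + q) = shift p + shift q" "shift (p * q) = shift p * shift q"
  "shift (p ^ n) = shift p ^ n"
  by (simp_all only: pcompose_add pcompose_mult bit_poly_pcompose_power)

lemma shift_geo: "shift (geo n y) = geo n (shift y)"
  by (simp add: geo_def pcompose_sum bit_poly_pcompose_power)

lemma shift_irreducible: "irreducible (shift p) \<longleftrightarrow> irreducible p"
proof -
  have "irreducible (shift p)" if p: "irreducible p" for p
  proof (rule irreducibleI)
    show "shift p \<noteq> 0" "\<not> is_unit (shift p)"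
      using p by (auto simp: irreducible_def shift_eq_iff)
    fix a b assume "shift p = a * b"
    then have "p = shift a * shift b" by (simp only: shift_eq_iff shift_simps)
    then have "shift a = 1 \<or> shift b = 1" using irreducibleD[OF p] by (metis bit_poly_is_unit_iff)
    then show "is_unit a \<or> is_unit b" by (auto simp: shift_eq_iff)
  qed
  from this[of p] this[of "shift p"] show ?thesis by auto
qed

lemma geo_Fermat_irreducible:
  assumes "X = pX \<or> X = pX + 1" "irreducible (geo (2 ^ t + 1) X)"
  shows "t \<le> 2"
  using assms geo_Fermat_irreducible_pX[of t] shift_irreducible[of "geo (2 ^ t + 1) pX"]
  by (auto simp only: shift_geo shift_pX)

lemma geo_eq_two_Mersenne:
  assumes X: "X = pX \<or> X = pX + 1"
    and irr: "irreducible P" "irreducible Q" and u: "geo u X = P * Q" "u > 0"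
    and M: "i > 0" "j > 0" "P + 1 = X ^ i * (X + 1) ^ j"
  shows "Q = X ^ (i + j) + (X + 1) ^ j \<or>
    (\<exists>f>0. i = 1 \<and> j = 2 ^ f - 1 \<and> P = geo (2 ^ f + 1) X \<and>
       Q + 1 = X ^ (2 ^ f + 1) * (X + 1) ^ (2 ^ f - 1) * P ^ (2 ^ f - 1))"
  using X
proof
  assume "X = pX"
  then show ?thesis using geo_eq_two_Mersenne_pX assms by blast
next
  assume X: "X = pX + 1"
  then have sX: "shift X = pX" by (simp only: shift_eq_iff shift_pX)
  have "shift (geo u X) = shift (P * Q)" "shift (P + 1) = shift (X ^ i * (X + 1) ^ j)"
    using u M by simp_all
  then have *: "geo u pX = shift P * shift Q" "shift P + 1 = pX ^ i * (pX + 1) ^ j"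
    by (simp_all only: shift_simps shift_geo sX shift_1)
  have "shift Q = shift (X ^ (i + j) + (X + 1) ^ j) \<or>
    (\<exists>f>0. i = 1 \<and> j = 2 ^ f - 1 \<and> shift P = shift (geo (2 ^ f + 1) X) \<and>
       shift (Q + 1) = shift (X ^ (2 ^ f + 1) * (X + 1) ^ (2 ^ f - 1) * P ^ (2 ^ f - 1)))"
    using geo_eq_two_Mersenne_pX[OF _ _ *(1) u(2) M(1,2) *(2)] irr
    by (simp only: shift_simps shift_geo sX shift_1 shift_irreducible)
  then show ?thesis by (simp only: shift_inj)
qed

section \<open>Products of powers of four primes\<close>

locale two_odd_primes =
  fixes X P Q :: "bit poly"
  assumes X: "X = pX \<or> X = pX + 1"
    and irr: "irreducible P" "irreducible Q"
    and distinct: "P \<noteq> Q" "P \<noteq> X" "P \<noteq> X + 1" "Q \<noteq> X" "Q \<noteq> X + 1"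
begin

text \<open>The general polynomial with no prime divisors other than \<open>X\<close>, \<open>X + 1\<close>, \<open>P\<close>, \<open>Q\<close>.\<close>

definition M :: "nat \<Rightarrow> nat \<Rightarrow> nat \<Rightarrow> nat \<Rightarrow> bit poly" where
  "M e f g h = X ^ e * (X + 1) ^ f * P ^ g * Q ^ h"

lemma degX [simp]: "degree X = 1" "degree (X + 1) = 1" "pderiv X = 1" "X \<noteq> X + 1"
  using X by (auto simp: one_pCons pderiv_pCons)

lemma X1: "X + 1 = pX \<or> X + 1 = pX + 1"
  using X by (auto simp: one_pCons)

lemma irrX: "irreducible X" "irreducible (X + 1)"
  by (simp_all add: degree_1_irreducible)

lemma nz: "X \<noteq> 0" "X + 1 \<noteq> 0" "P \<noteq> 0" "Q \<noteq> 0"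
  using irrX irr by (auto simp: irreducible_def)

lemma ndvd: "\<not> X dvd P" "\<not> X + 1 dvd P" "\<not> X dvd Q" "\<not> X + 1 dvd Q" "\<not> P dvd Q" "\<not> Q dvd P"
  "\<not> P dvd X" "\<not> Q dvd X" "\<not> P dvd X + 1" "\<not> Q dvd X + 1" "\<not> X dvd X + 1" "\<not> X + 1 dvd X"
  using irr irrX distinct degX(4) irreducible_dvd_irreducible by metis+

lemma M_inj: "M e f g h = M e' f' g' h' \<longleftrightarrow> e = e' \<and> f = f' \<and> g = g' \<and> h = h'"
proof -
  have pe: "prime_elem X" "prime_elem (X + 1)" "prime_elem P" "prime_elem Q"
    using irr irrX by (auto simp: prime_elem_iff_irreducible)
  have "multiplicity X (M e f g h) = e" "multiplicity (X + 1) (M e f g h) = f"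
    "multiplicity P (M e f g h) = g" "multiplicity Q (M e f g h) = h" for e f g h
    using pe nz ndvd
    by (simp_all add: M_def prime_elem_multiplicity_mult_distrib prime_elem_multiplicity_power_distrib
        not_dvd_imp_multiplicity_0)
  then show ?thesis by metis
qed

lemma M_mult: "M e f g h * M e' f' g' h' = M (e + e') (f + f') (g + g') (h + h')"
  by (simp add: M_def power_add ac_simps)

lemma M_power: "M e f g h ^ n = M (e * n) (f * n) (g * n) (h * n)"
  by (simp add: M_def power_mult_distrib power_mult)

lemma dvd_M: assumes "D dvd M e f g h" obtains e' f' g' h' where "D = M e' f' g' h'"
proof -
  have *: "\<exists>m. d = p ^ m" if "irreducible p" "d dvd p ^ n" for d p :: "bit poly" and n
    using divides_primepow[of p d n] that by (auto simp: bit_poly_prime_iff)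
  obtain D1 Dh where 1: "D = D1 * Dh" "D1 dvd X ^ e * (X + 1) ^ f * P ^ g" "Dh dvd Q ^ h"
    using assms division_decomp unfolding M_def by blast
  obtain D2 Dg where 2: "D1 = D2 * Dg" "D2 dvd X ^ e * (X + 1) ^ f" "Dg dvd P ^ g"
    using 1 division_decomp by blast
  obtain De Df where 3: "D2 = De * Df" "De dvd X ^ e" "Df dvd (X + 1) ^ f"
    using 2 division_decomp by blast
  obtain e' f' g' h' where "De = X ^ e'" "Df = (X + 1) ^ f'" "Dg = P ^ g'" "Dh = Q ^ h'"
    using *[OF irrX(1) 3(2)] *[OF irrX(2) 3(3)] *[OF irr(1) 2(3)] *[OF irr(2) 1(3)] by blast
  then show ?thesis using that 1 2 3 by (auto simp: M_def)
qed

lemma dvd_M_iff: "X dvd M e f g h \<longleftrightarrow> e > 0" "X + 1 dvd M e f g h \<longleftrightarrow> f > 0"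
   "P dvd M e f g h \<longleftrightarrow> g > 0" "Q dvd M e f g h \<longleftrightarrow> h > 0"
proof -
  have *: "p dvd q ^ n \<longleftrightarrow> p dvd q \<and> n > 0" if "irreducible p" for p q :: "bit poly" and n
    using irreducible_dvd_power[OF that, of q n] that by (cases n) (auto simp: irreducible_def)
  show "X dvd M e f g h \<longleftrightarrow> e > 0" "X + 1 dvd M e f g h \<longleftrightarrow> f > 0"
   "P dvd M e f g h \<longleftrightarrow> g > 0" "Q dvd M e f g h \<longleftrightarrow> h > 0"
    using ndvd irr irrX by (simp_all add: M_def irreducible_dvd_mult *)
qed

lemma degree_M: "degree (M e f g h) = e + f + g * degree P + h * degree Q"
  using nz by (simp add: M_def degree_mult_eq degree_power_eq)

lemma X_root: obtains z where "poly X z = 0" "poly (X + 1) z = 1" "\<And>f. X dvd f \<longleftrightarrow> poly f z = 0"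
  using linear_root[OF X] by blast

lemma X1_root: obtains z where "poly (X + 1) z = 0" "poly X z = 1" "\<And>f. X + 1 dvd f \<longleftrightarrow> poly f z = 0"
  using linear_root[OF X1] by (metis add.assoc bit_poly_add_self add.right_neutral)

lemma X_dvd_P1: "X dvd P + 1" "X + 1 dvd P + 1" "X dvd Q + 1" "X + 1 dvd Q + 1"
proof -
  obtain z where z: "\<And>f. X dvd f \<longleftrightarrow> poly f z = 0" using X_root by blast
  have "X dvd P + 1 \<and> X dvd Q + 1" using ndvd unfolding z by simp
  moreover obtain z' where z': "\<And>f. X + 1 dvd f \<longleftrightarrow> poly f z' = 0" using X1_root by blast
  have "X + 1 dvd P + 1 \<and> X + 1 dvd Q + 1" using ndvd unfolding z' by simp
  ultimately show "X dvd P + 1" "X + 1 dvd P + 1" "X dvd Q + 1" "X + 1 dvd Q + 1" by auto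
qed

text \<open>Evaluate at the root of the linear polynomial.  Where the argument is \<open>0\<close> only the constant term
  survives, and where it is \<open>1\<close> an odd number of ones is added up.\<close>

lemma geo_odd_ndvd:
  assumes "odd m"
  shows "\<not> X dvd geo m X" "\<not> X + 1 dvd geo m X" "\<not> X dvd geo m (X + 1)" "\<not> X + 1 dvd geo m (X + 1)"
    "\<not> X dvd geo m P" "\<not> X + 1 dvd geo m P" "\<not> X dvd geo m Q" "\<not> X + 1 dvd geo m Q"
proof -
  have m: "m > 0" using assms by (rule odd_pos)
  obtain z where z: "\<And>f. X dvd f \<longleftrightarrow> poly f z = 0" using X_root by blast
  obtain z' where z': "\<And>f. X + 1 dvd f \<longleftrightarrow> poly f z' = 0" using X1_root by blast
  show "\<not> X dvd geo m X" "\<not> X dvd geo m (X + 1)" "\<not> X dvd geo m P" "\<not> X dvd geo m Q"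
    unfolding z using assms m by (simp_all add: poly_geo)
  show "\<not> X + 1 dvd geo m X" "\<not> X + 1 dvd geo m (X + 1)" "\<not> X + 1 dvd geo m P" "\<not> X + 1 dvd geo m Q"
    unfolding z' using assms m by (simp_all add: poly_geo)
qed

lemma geo_self_ndvd: assumes "irreducible R" "n > 0" shows "\<not> R dvd geo n R"
  using geo_Suc_shift[of "n - 1" R] assms by (auto simp: dvd_add_left_iff irreducible_def)

lemma geo_X_form:
  assumes "odd u" "geo u X dvd M e f g h"
  obtains a1 a2 where "a1 \<le> 1" "a2 \<le> 1" "geo u X = M 0 0 a1 a2"
proof -
  obtain e1 e2 a1 a2 where eq: "geo u X = M e1 e2 a1 a2" using dvd_M assms by blast
  have "e1 = 0" "e2 = 0" using geo_odd_ndvd[OF assms(1)] by (auto simp: eq dvd_M_iff)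
  moreover have "\<not> R ^ 2 dvd M e1 e2 a1 a2" if "irreducible R" for R
    using geo_squarefree[OF assms(1) degX(3) that] eq by auto
  from this[OF irr(1)] this[OF irr(2)] have "a1 \<le> 1" "a2 \<le> 1"
    unfolding M_def using le_imp_power_dvd[of 2 a1 P] le_imp_power_dvd[of 2 a2 Q]
    by (fastforce intro: dvd_mult dvd_mult2 simp: not_le)+
  ultimately show ?thesis using that eq by blast
qed

text \<open>The roles of \<open>X\<close> and \<open>X + 1\<close> are symmetric; the following two lemmas let every statement be
  applied to either.\<close>

lemma swap: "two_odd_primes (X + 1) P Q"
  using irr distinct X1 by unfold_locales (auto simp: add.assoc)

lemma swap_M: "two_odd_primes.M (X + 1) P Q e f g h = M f e g h"
  by (simp add: two_odd_primes.M_def[OF swap] M_def add.assoc mult.commute)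

lemma geo_X1_form:
  assumes "odd u" "geo u (X + 1) dvd M e f g h"
  obtains a1 a2 where "a1 \<le> 1" "a2 \<le> 1" "geo u (X + 1) = M 0 0 a1 a2"
  using two_odd_primes.geo_X_form[OF swap] assms by (metis swap_M)

text \<open>Compare exponents in \<open>R + 1 = X * (X + 1) ^ (2 ^ t - 1) * geo m X ^ 2 ^ t\<close>, where \<open>u = 2 ^ t * m + 1\<close>:
  the squarefree polynomial \<open>geo m X\<close> can only be \<open>1\<close> or \<open>P\<close>.\<close>

lemma geo_X_minus_1_form:
  assumes R: "R = geo u X" "odd u" "u > 1" "R + 1 = M k l s 0"
  obtains t where "t > 0" "k = 1" "l = 2 ^ t - 1" "s = 0" "u = 2 ^ t + 1"
    | t m where "t > 0" "k = 1" "l = 2 ^ t - 1" "s = 2 ^ t" "P = geo m X" "odd m"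
proof -
  obtain t m where tm: "t > 0" "odd m" "u = 2 ^ t * m + 1"
    "geo u X + 1 = X * (1 + X) ^ (2 ^ t - 1) * geo m X ^ 2 ^ t"
    using geo_odd_minus_1[OF R(2,3)] by blast
  then have eq: "M k l s 0 = X * (X + 1) ^ (2 ^ t - 1) * geo m X ^ 2 ^ t"
    using R by (simp add: add.commute)
  then have "geo m X dvd M k l s 0" by (simp add: dvd_power)
  then obtain a1 a2 where a: "a1 \<le> 1" "a2 \<le> 1" "geo m X = M 0 0 a1 a2"
    using geo_X_form tm(2) by blast
  have "X * (X + 1) ^ (2 ^ t - 1) = M 1 (2 ^ t - 1) 0 0" by (simp add: M_def)
  then have "M k l s 0 = M 1 (2 ^ t - 1) (a1 * 2 ^ t) (a2 * 2 ^ t)"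
    unfolding eq by (simp add: a(3) M_power M_mult)
  then have e: "k = 1" "l = 2 ^ t - 1" "s = a1 * 2 ^ t" "a2 = 0" unfolding M_inj by auto
  show ?thesis
  proof (cases "a1 = 0")
    case True
    then have "m = 1" using a e geo_eq_1_iff[of X m] odd_pos[OF tm(2)] by (simp add: M_def)
    then show ?thesis using that(1)[of t] e tm True by simp
  next
    case False
    then have "a1 = 1" using a(1) by simp
    then have "P = geo m X" using a e by (simp add: M_def)
    then show ?thesis using that(2)[of t m] e tm \<open>a1 = 1\<close> by simp
  qed
qed

end

section \<open>The exponent equations of a perfect polynomial\<close>

text \<open>The exponents of \<open>X\<close>, \<open>X + 1\<close>, \<open>P\<close>, \<open>Q\<close> in the perfect polynomial are written as
  \<open>2 ^ \<alpha> * u - 1\<close>, \<open>2 ^ \<beta> * v - 1\<close>, \<open>2 ^ \<gamma> * w - 1\<close>, \<open>2 ^ \<delta> - 1\<close>.  The zero-one numbers \<open>a1\<close>, \<open>a2\<close>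
  record whether \<open>P\<close>, \<open>Q\<close> divide \<open>geo u X\<close>; likewise \<open>b1\<close>, \<open>b2\<close> for \<open>geo v (X + 1)\<close>, and \<open>w2\<close> for
  \<open>Q\<close> and \<open>geo w P\<close>.  The facts \<open>Ex\<close>, \<open>Ey\<close>, \<open>Ep\<close>, \<open>Eq\<close> equate the exponents of the four primes on both
  sides of \<open>sigma A = A\<close>, with one added on both sides to avoid truncated subtraction.  The
  conditions are invariant under exchanging \<open>X\<close> with \<open>X + 1\<close> together with the parameters attached to
  them.\<close>

locale perfect_exponents = two_odd_primes +
  fixes \<alpha> \<beta> \<gamma> \<delta> u v w a1 a2 b1 b2 w2 i j k l s :: nat
  assumes deg_le: "degree P \<le> degree Q"
    and odd: "odd u" "odd v" "odd w"
    and pos: "\<delta> > 0" "i > 0" "j > 0" "k > 0" "l > 0" "2 ^ \<gamma> * w \<ge> 2"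
    and bounds: "a1 \<le> 1" "a2 \<le> 1" "b1 \<le> 1" "b2 \<le> 1" "w2 \<le> 1"
    and U: "geo u X = M 0 0 a1 a2"
    and V: "geo v (X + 1) = M 0 0 b1 b2"
    and W: "geo w P = M 0 0 0 w2"
    and P1: "P + 1 = M i j 0 0"
    and Q1: "Q + 1 = M k l s 0"
    and Ex: "2 ^ \<alpha> * u = 2 ^ \<beta> + (2 ^ \<gamma> - 1) * i + (2 ^ \<delta> - 1) * k"
    and Ey: "2 ^ \<beta> * v = 2 ^ \<alpha> + (2 ^ \<gamma> - 1) * j + (2 ^ \<delta> - 1) * l"
    and Ep: "2 ^ \<gamma> * w = 1 + a1 * 2 ^ \<alpha> + b1 * 2 ^ \<beta> + (2 ^ \<delta> - 1) * s"
    and Eq: "2 ^ \<delta> = 1 + a2 * 2 ^ \<alpha> + b2 * 2 ^ \<beta> + w2 * 2 ^ \<gamma>"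

context two_odd_primes
begin

text \<open>That \<open>geo w' Q = 1\<close> for the odd part \<open>w'\<close> of \<open>d + 1\<close> comes from \<open>degree P \<le> degree Q\<close>: otherwise
  \<open>geo w' Q = P\<close> has degree at least \<open>2 * degree Q\<close>.  So \<open>d + 1\<close> is a power of two, and \<open>Q + 1\<close> divides
  \<open>A\<close>.  If \<open>c\<close> is odd, \<open>P + 1\<close> divides \<open>geo (c + 1) P\<close> and hence \<open>A\<close>; if \<open>c\<close> is even, then
  \<open>geo (c + 1) P = Q\<close> and \<open>P + 1\<close> divides \<open>Q + 1 = P * geo c P\<close>.\<close>

lemma perfect_exponents_exist:
  assumes deg_le: "degree P \<le> degree Q"
    and pos: "a > 0" "b > 0" "c > 0" "d > 0"
    and perfect: "geo (a + 1) X * geo (b + 1) (X + 1) * geo (c + 1) P * geo (d + 1) Q = M a b c d"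
  obtains \<alpha> \<beta> \<gamma> \<delta> u v w a1 a2 b1 b2 w2 i j k l s where
    "perfect_exponents X P Q \<alpha> \<beta> \<gamma> \<delta> u v w a1 a2 b1 b2 w2 i j k l s"
    "a = 2 ^ \<alpha> * u - 1" "b = 2 ^ \<beta> * v - 1" "c = 2 ^ \<gamma> * w - 1" "d = 2 ^ \<delta> - 1"
proof -
  obtain \<alpha> u where a: "a + 1 = 2 ^ \<alpha> * u" "odd u" using odd_part[of "a + 1"] by auto
  obtain \<beta> v where b: "b + 1 = 2 ^ \<beta> * v" "odd v" using odd_part[of "b + 1"] by auto
  obtain \<gamma> w where c: "c + 1 = 2 ^ \<gamma> * w" "odd w" using odd_part[of "c + 1"] by auto
  obtain \<delta> w' where d: "d + 1 = 2 ^ \<delta> * w'" "odd w'" using odd_part[of "d + 1"] by auto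
  have ga: "geo (a + 1) X = (X + 1) ^ (2 ^ \<alpha> - 1) * geo u X ^ 2 ^ \<alpha>"
    unfolding a by (simp add: geo_pow2_mult add.commute)
  have gb: "geo (b + 1) (X + 1) = X ^ (2 ^ \<beta> - 1) * geo v (X + 1) ^ 2 ^ \<beta>"
    unfolding b by (simp add: geo_pow2_mult add.commute)
  have gc: "geo (c + 1) P = (P + 1) ^ (2 ^ \<gamma> - 1) * geo w P ^ 2 ^ \<gamma>"
    unfolding c by (simp add: geo_pow2_mult add.commute)
  have gd: "geo (d + 1) Q = (Q + 1) ^ (2 ^ \<delta> - 1) * geo w' Q ^ 2 ^ \<delta>"
    unfolding d by (simp add: geo_pow2_mult add.commute)
  have dvds: "geo (a + 1) X dvd M a b c d" "geo (b + 1) (X + 1) dvd M a b c d"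
    "geo (c + 1) P dvd M a b c d" "geo (d + 1) Q dvd M a b c d"
    unfolding perfect[symmetric] by (simp_all add: dvd_mult dvd_mult2)
  have factor: "R dvd Z" if "S * R ^ 2 ^ n dvd Z" for R S Z :: "bit poly" and n
    using dvd_trans[of R "S * R ^ 2 ^ n" Z] that by (simp add: dvd_power dvd_mult)
  obtain a1 a2 where U: "a1 \<le> 1" "a2 \<le> 1" "geo u X = M 0 0 a1 a2"
    using geo_X_form[OF a(2) factor] dvds(1) unfolding ga by metis
  obtain b1 b2 where V: "b1 \<le> 1" "b2 \<le> 1" "geo v (X + 1) = M 0 0 b1 b2"
    using geo_X1_form[OF b(2) factor] dvds(2) unfolding gb by metis
  obtain w1 w3 w4 w2 where W: "geo w P = M w1 w3 w4 w2"
    using dvd_M[OF factor] dvds(3) unfolding gc by metis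
  obtain q1 q2 q3 q4 where W': "geo w' Q = M q1 q2 q3 q4"
    using dvd_M[OF factor] dvds(4) unfolding gd by metis
  have wpos: "w > 0" "w' > 0" using c(2) d(2) by (auto intro: odd_pos)
  have dP: "degree P > 0" and dQ: "degree Q > 0" using irr irreducible_degree_pos by auto
  have "w1 = 0" "w3 = 0" "w4 = 0" using geo_odd_ndvd[OF c(2)] geo_self_ndvd[OF irr(1) wpos(1)]
    by (auto simp: W dvd_M_iff)
  then have W: "geo w P = M 0 0 0 w2" using W by simp
  then have w2: "w2 \<le> 1" using geo_eq_prime_power[OF irr c(2)] by (simp add: M_def)
  have "q1 = 0" "q2 = 0" "q4 = 0" using geo_odd_ndvd[OF d(2)] geo_self_ndvd[OF irr(2) wpos(2)]
    by (auto simp: W' dvd_M_iff)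
  then have W': "geo w' Q = M 0 0 q3 0" using W' by simp
  then have "q3 \<le> 1" using geo_eq_prime_power[OF irr(2,1) d(2)] by (simp add: M_def)
  moreover have "(w' - 1) * degree Q = q3 * degree P"
    using degree_geo[OF wpos(2) dQ] unfolding W' degree_M by simp
  ultimately have "(w' - 1) * degree Q \<le> 1 * degree Q"
    using deg_le mult_le_mono[of q3 1 "degree P" "degree Q"] by simp
  then have "w' \<le> 2" using dQ by simp
  then have w': "w' = 1" using d(2) wpos(2) by (cases "w' = 2") auto
  have \<delta>: "d + 1 = 2 ^ \<delta>" "\<delta> > 0" using d w' pos(4) by (auto intro!: gr0I)
  have gd: "geo (d + 1) Q = (Q + 1) ^ (2 ^ \<delta> - 1)" using gd w' by simp
  have "(2::nat) ^ n - 1 > 0" if "n > 0" for n using that one_less_power[of "2::nat" n] by simp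
  then have Q1dvd: "Q + 1 dvd M a b c d"
    using dvds(4) \<delta>(2) unfolding gd by (meson dvd_power dvd_trans)
  then obtain k l s q where "Q + 1 = M k l s q" using dvd_M by blast
  moreover have "\<not> Q dvd Q + 1" using irr(2) by (simp add: irreducible_def)
  ultimately have Q1: "Q + 1 = M k l s 0" by (metis dvd_M_iff(4) gr0I)
  have kl: "k > 0" "l > 0" using X_dvd_P1(3,4) unfolding Q1 dvd_M_iff by auto
  have "P + 1 dvd M a b c d"
  proof (cases "\<gamma> = 0")
    case False
    then have "P + 1 dvd (P + 1) ^ (2 ^ \<gamma> - 1)" using \<open>\<And>n. n > 0 \<Longrightarrow> (2::nat) ^ n - 1 > 0\<close> by (metis dvd_power gr0I)
    then show ?thesis using dvds(3) unfolding gc by (meson dvd_trans dvd_mult2)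
  next
    case True
    then have w: "w = c + 1" using c by simp
    then have "w2 \<noteq> 0" using geo_eq_1_iff[OF dP wpos(1)] W pos(3) by (intro notI) (simp add: M_def)
    then have "geo w P = Q" using W w2 by (simp add: M_def le_Suc_eq)
    then have Q: "Q + 1 = P * geo c P" using geo_Suc_shift[of c P] w by (simp add: bit_poly_add_eq_iff add.commute)
    have "even c" using c(2) w by simp
    then have "geo 2 P dvd geo c P" using geo_dvd_geo_iff[OF dP, of 2 c] by simp
    moreover have "geo 2 P = P + 1" by (simp add: numeral_2_eq_2 geo_Suc add.commute)
    ultimately have "P + 1 dvd Q + 1" unfolding Q by simp
    then show ?thesis using Q1dvd dvd_trans by blast
  qed
  then obtain i j p q where P1: "P + 1 = M i j p q" using dvd_M by blast
  moreover have "\<not> P dvd P + 1" using irr(1) by (simp add: irreducible_def)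
  ultimately have "p = 0" by (metis dvd_M_iff(3) gr0I)
  have "q = 0"
  proof (rule ccontr)
    assume "q \<noteq> 0"
    then have "Q dvd P + 1" unfolding P1 by (simp add: dvd_M_iff)
    moreover from dP have "degree (P + 1) = degree P" by (simp add: degree_add_eq_left)
    moreover have "P + 1 \<noteq> 0" using dP \<open>degree (P + 1) = degree P\<close> by (intro notI) simp
    ultimately have "Q = P + 1" using deg_le dvd_imp_degree_le[of Q "P + 1"]
      by (intro bit_poly_dvd_degree_eq) auto
    then show False using X_dvd_P1(1) ndvd(3) by simp
  qed
  with P1 \<open>p = 0\<close> have P1: "P + 1 = M i j 0 0" by simp
  have ij: "i > 0" "j > 0" using X_dvd_P1(1,2) unfolding P1 dvd_M_iff by auto
  have "M a b c d = M 0 (2 ^ \<alpha> - 1) 0 0 * M 0 0 a1 a2 ^ 2 ^ \<alpha> * (M (2 ^ \<beta> - 1) 0 0 0 * M 0 0 b1 b2 ^ 2 ^ \<beta>)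
     * (M i j 0 0 ^ (2 ^ \<gamma> - 1) * M 0 0 0 w2 ^ 2 ^ \<gamma>) * M k l s 0 ^ (2 ^ \<delta> - 1)"
    unfolding perfect[symmetric] ga gb gc gd U V W P1 Q1 by (simp add: M_def)
  then have E: "a = (2 ^ \<beta> - 1) + (2 ^ \<gamma> - 1) * i + (2 ^ \<delta> - 1) * k"
    "b = (2 ^ \<alpha> - 1) + (2 ^ \<gamma> - 1) * j + (2 ^ \<delta> - 1) * l"
    "c = a1 * 2 ^ \<alpha> + b1 * 2 ^ \<beta> + (2 ^ \<delta> - 1) * s"
    "d = a2 * 2 ^ \<alpha> + b2 * 2 ^ \<beta> + w2 * 2 ^ \<gamma>"
    unfolding M_power M_mult M_inj by (simp_all add: mult.commute)
  have p2: "(2::nat) ^ n \<ge> 1" for n by simp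
  show ?thesis
  proof (rule that)
    show "perfect_exponents X P Q \<alpha> \<beta> \<gamma> \<delta> u v w a1 a2 b1 b2 w2 i j k l s"
    proof
      show "2 ^ \<gamma> * w \<ge> 2" using c(1) pos(3) by simp
      show "2 ^ \<alpha> * u = 2 ^ \<beta> + (2 ^ \<gamma> - 1) * i + (2 ^ \<delta> - 1) * k"
        using E(1) a(1) p2[of \<beta>] by linarith
      show "2 ^ \<beta> * v = 2 ^ \<alpha> + (2 ^ \<gamma> - 1) * j + (2 ^ \<delta> - 1) * l"
        using E(2) b(1) p2[of \<alpha>] by linarith
      show "2 ^ \<gamma> * w = 1 + a1 * 2 ^ \<alpha> + b1 * 2 ^ \<beta> + (2 ^ \<delta> - 1) * s"
        using E(3) c(1) by linarith
      show "2 ^ \<delta> = 1 + a2 * 2 ^ \<alpha> + b2 * 2 ^ \<beta> + w2 * 2 ^ \<gamma>"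
        using E(4) \<delta>(1) by linarith
    qed (use assms U V W P1 Q1 w2 a b c \<delta> kl ij in auto)
  qed (use a b c \<delta> in auto)
qed

end

section \<open>Solving the exponent equations\<close>

definition sporadic_form :: "bit poly \<Rightarrow> bit poly \<Rightarrow> bool" where
  "sporadic_form A Z \<longleftrightarrow>
     A = Z ^ 2 * (Z + 1) * (Z ^ 2 + Z + 1) ^ 2 * (Z ^ 4 + Z + 1) \<or>
     A = Z ^ 4 * (Z + 1) ^ 4 * geo 5 Z * geo 5 (Z + 1) \<or>
     A = Z ^ 6 * (Z + 1) ^ 3 * geo 7 Z"

text \<open>Equations between powers of two are decided modulo four, once the values \<open>1\<close> and \<open>2\<close> are set
  apart.\<close>

lemma pow2_cases:
  obtains "n = 0" "2 ^ n = (1::nat)" | "n = 1" "2 ^ n = (2::nat)"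
  | m where "n = m + 2" "2 ^ n = 4 * (2::nat) ^ m" "2 ^ m \<ge> (1::nat)"
proof (cases "n < 2")
  case True
  then have "n = 0 \<or> n = 1" by auto
  then show ?thesis using that(1,2) by auto
next
  case False
  then obtain m where "n = m + 2" by (metis add.commute le_Suc_ex not_less)
  then show ?thesis using that(3)[of m] by simp
qed

context perfect_exponents
begin

abbreviation "A \<equiv> M (2 ^ \<alpha> * u - 1) (2 ^ \<beta> * v - 1) (2 ^ \<gamma> * w - 1) (2 ^ \<delta> - 1)"

abbreviation "result \<equiv> sporadic_form A X \<or> sporadic_form A (X + 1)"

lemma swap_perfect_exponents: "perfect_exponents (X + 1) P Q \<beta> \<alpha> \<gamma> \<delta> v u w b1 b2 a1 a2 w2 j i l k s"
proof -
  interpret sw: two_odd_primes "X + 1" P Q by (rule swap)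
  have [simp]: "X + 1 + 1 = X" by (simp add: add.assoc)
  show ?thesis
    by unfold_locales (use deg_le odd pos bounds U V W P1 Q1 Ex Ey Ep Eq in \<open>simp_all add: swap_M\<close>)
qed

lemma degs: "degree P = i + j" "degree Q = k + l + s * (i + j)"
  "u = Suc (a1 * degree P + a2 * degree Q)" "v = Suc (b1 * degree P + b2 * degree Q)"
  "(w - 1) * degree P = w2 * degree Q"
proof -
  have dP: "degree P > 0" "degree Q > 0" using irr irreducible_degree_pos by auto
  then have "degree (P + 1) = degree P" "degree (Q + 1) = degree Q"
    by (simp_all add: degree_add_eq_left)
  then show p: "degree P = i + j" and "degree Q = k + l + s * (i + j)"
    unfolding P1 Q1 degree_M by simp_all
  have "u > 0" "v > 0" "w > 0" using odd by (auto intro: odd_pos)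
  then show "u = Suc (a1 * degree P + a2 * degree Q)" "v = Suc (b1 * degree P + b2 * degree Q)"
     "(w - 1) * degree P = w2 * degree Q"
    using arg_cong[OF U, of degree] arg_cong[OF V, of degree] arg_cong[OF W, of degree] dP
    by (auto simp: degree_M degree_geo)
qed

lemma U_eq_P:
  assumes "a1 = 1" "a2 = 0"
  obtains t where "t > 0" "i = 1" "j = 2 ^ t - 1" "u = 2 ^ t + 1" "P = geo (2 ^ t + 1) X"
proof -
  have P: "P = geo u X" using U assms by (simp add: M_def)
  have "u > 1" using degs(3) assms pos by (simp add: degs(1))
  then show ?thesis using geo_X_minus_1_form[OF P odd(1) _ P1] that P by (metis less_not_refl zero_less_power zero_less_numeral)
qed

text \<open>The second alternative occurs for \<open>Q + 1 = X * (X + 1) ^ (2 ^ t - 1) * P ^ 2 ^ t\<close>; then \<open>P\<close> is itself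
  some \<open>geo m X\<close>, whence \<open>i = 1\<close>.\<close>

lemma U_eq_Q:
  assumes "a1 = 0" "a2 = 1"
  obtains t where "t > 0" "k = 1" "l = 2 ^ t - 1" "s = 0" "u = 2 ^ t + 1" "Q = geo (2 ^ t + 1) X"
    | t where "t > 0" "k = 1" "l = 2 ^ t - 1" "s = 2 ^ t" "i = 1"
proof -
  have Q: "Q = geo u X" using U assms by (simp add: M_def)
  have "u > 1" using degs(3) assms pos by (simp add: degs(2))
  from Q odd(1) this Q1 show ?thesis
  proof (cases rule: geo_X_minus_1_form)
    case (1 t)
    then show ?thesis using that(1) Q by simp
  next
    case (2 t m)
    have "m > 1" using \<open>P = geo m X\<close> \<open>odd m\<close> irr(1) by (cases "m = 1") (auto simp: irreducible_def intro: Suc_lessI odd_pos)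
    with 2(5,6) have "i = 1" using geo_X_minus_1_form[OF _ _ _ P1] by metis
    then show ?thesis using that(2) 2 by blast
  qed
qed

text \<open>The case distinction of \<open>geo_eq_two_Mersenne\<close>: when \<open>Q\<close> is the reversal of \<open>P\<close>, equality of the
  degrees excludes \<open>P\<close> from \<open>Q + 1\<close>.\<close>

lemma U_eq_PQ:
  assumes "a1 = 1" "a2 = 1"
  obtains "s = 0" "k + l = i + j" "Q = X ^ (i + j) + (X + 1) ^ j"
    | f where "f > 0" "i = 1" "j = 2 ^ f - 1" "k = 2 ^ f + 1" "l = 2 ^ f - 1" "s = 2 ^ f - 1"
proof -
  have PQ: "geo u X = P * Q" using U assms by (simp add: M_def)
  have u: "u > 0" using odd(1) by (rule odd_pos)
  have "P + 1 = X ^ i * (X + 1) ^ j" using P1 by (simp add: M_def)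
  from geo_eq_two_Mersenne[OF X irr PQ u pos(2,3) this] show ?thesis
  proof (elim disjE exE conjE)
    assume Q: "Q = X ^ (i + j) + (X + 1) ^ j"
    then have "degree Q \<le> i + j" by (simp add: degree_add_le degree_power_eq nz)
    moreover have "s = 0"
    proof (rule ccontr)
      assume "s \<noteq> 0"
      then have "i + j \<le> s * (i + j)" by simp
      then show False using \<open>degree Q \<le> i + j\<close> degs(2) pos by linarith
    qed
    ultimately have "s = 0" "k + l = i + j" using degs(1,2) deg_le by simp_all
    then show ?thesis using that(1) Q by blast
  next
    fix f assume f: "0 < f" "i = 1" "j = 2 ^ f - 1"
      "Q + 1 = X ^ (2 ^ f + 1) * (X + 1) ^ (2 ^ f - 1) * P ^ (2 ^ f - 1)"
    then have "M k l s 0 = M (2 ^ f + 1) (2 ^ f - 1) (2 ^ f - 1) 0"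
      using Q1 by (simp add: M_def)
    then show ?thesis using that(2) f unfolding M_inj by blast
  qed
qed

text \<open>If \<open>geo w P = Q\<close>, then \<open>Q + 1 = P * (P + 1) ^ (2 ^ n - 1) * geo m P ^ 2 ^ n\<close>, and \<open>geo m P\<close> is coprime
  to \<open>X\<close>, \<open>X + 1\<close>, \<open>P\<close>, the only primes that divide \<open>Q + 1\<close>.\<close>

lemma w_form:
  assumes "w2 = 1"
  obtains n where "n > 0" "w = 2 ^ n + 1" "s = 1" "k = i * (2 ^ n - 1)" "l = j * (2 ^ n - 1)"
proof -
  have Q: "Q = geo w P" using W assms by (simp add: M_def)
  have "w > 1" using degs(5) assms pos by (cases "w = 0 \<or> w = 1") (auto simp: degs(2))
  then obtain n m where nm: "n > 0" "odd m" "w = 2 ^ n * m + 1"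
    "Q + 1 = P * (1 + P) ^ (2 ^ n - 1) * geo m P ^ 2 ^ n"
    using geo_odd_minus_1[OF odd(3)] Q by metis
  have "geo m P dvd Q + 1" unfolding nm(4) by (simp add: dvd_power)
  then obtain e1 e2 e3 e4 where g: "geo m P = M e1 e2 e3 e4" using dvd_M unfolding Q1 by blast
  have "m > 0" using nm(2) by (rule odd_pos)
  then have "e1 = 0" "e2 = 0" "e3 = 0" using geo_odd_ndvd[OF nm(2)] geo_self_ndvd[OF irr(1) \<open>m > 0\<close>]
    by (auto simp: g dvd_M_iff)
  then have g: "geo m P = M 0 0 0 e4" using g by simp
  have "Q + 1 = M 0 0 1 0 * M i j 0 0 ^ (2 ^ n - 1) * geo m P ^ 2 ^ n"
    unfolding P1[symmetric] nm(4) by (simp add: M_def add.commute)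
  then have "M k l s 0 = M (i * (2 ^ n - 1)) (j * (2 ^ n - 1)) 1 (e4 * 2 ^ n)"
    unfolding g Q1 by (simp add: M_power M_mult)
  then have e: "k = i * (2 ^ n - 1)" "l = j * (2 ^ n - 1)" "s = 1" "e4 = 0" unfolding M_inj by auto
  then have "m = 1" using g geo_eq_1_iff[of P m] \<open>m > 0\<close> irreducible_degree_pos[OF irr(1)] by (simp add: M_def)
  then show ?thesis using that[of n] e nm by simp
qed

text \<open>Here \<open>s = 1\<close>, while \<open>geo u X = Q\<close> makes \<open>s\<close> equal to \<open>0\<close> or \<open>2 ^ t\<close> with \<open>t > 0\<close>.  If \<open>geo u X = P * Q\<close>, then
  \<open>s = 1\<close> forces \<open>k = 3\<close> and \<open>i = j = l = 1\<close>, against \<open>k = i * (2 ^ n - 1)\<close> and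
  \<open>l = j * (2 ^ n - 1)\<close>.\<close>

lemma w2_a2: assumes "w2 = 1" shows "a2 = 0"
proof (rule ccontr)
  assume "a2 \<noteq> 0"
  then have a2: "a2 = 1" using bounds by simp
  obtain n where n: "n > 0" "w = 2 ^ n + 1" "s = 1" "k = i * (2 ^ n - 1)" "l = j * (2 ^ n - 1)"
    using w_form assms by blast
  show False
  proof (cases "a1 = 0")
    case True
    then show False using a2 by (cases rule: U_eq_Q) (use n(3) pos in auto)
  next
    case False
    then have "a1 = 1" using bounds by simp
    then show False using a2
    proof (cases rule: U_eq_PQ)
      case 1
      then show False using n by simp
    next
      case (2 f)
      then show False using n by (cases f rule: pow2_cases) auto
    qed
  qed
qed

text \<open>The exponent equations are solved by \<open>P = geo (2 ^ t + 1) X\<close>, \<open>Q = geo 3 P\<close> for every \<open>t\<close>.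
  Irreducibility of \<open>P\<close> leaves \<open>t \<le> 2\<close>, and for \<open>t = 2\<close> the polynomial \<open>Q\<close> is divisible by
  \<open>X ^ 2 + X + 1\<close>.\<close>

lemma case_C1:
  assumes "w2 = 1" "a1 = 1" "a2 = 0" "b1 = 0" "b2 = 0" "\<alpha> = 0" "\<gamma> = 0" "\<delta> = 1" "w = 3"
  shows result
proof -
  obtain t where t: "t > 0" "i = 1" "j = 2 ^ t - 1" "u = 2 ^ t + 1" "P = geo (2 ^ t + 1) X"
    using U_eq_P assms by blast
  obtain n where n: "w = 2 ^ n + 1" "k = i * (2 ^ n - 1)" using w_form assms by blast
  then have k: "k = 1" using assms t by simp
  have "v = 1" using degs(4) assms by simp
  have Q: "Q = geo 3 P" using W assms by (simp add: M_def)
  have "t \<le> 2" using geo_Fermat_irreducible[OF X] t irr by blast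
  then consider "t = 1" | "t = 2" using t(1) by linarith
  then show ?thesis
  proof cases
    case 1
    then have P: "P = X ^ 2 + X + 1" using t by (simp add: geo_def numeral_eq_Suc algebra_simps)
    have Q: "Q = X ^ 4 + X + 1"
      unfolding Q P using X by (elim disjE) (simp_all add: geo_def numeral_eq_Suc one_pCons)
    have "2 ^ \<beta> = (2::nat)" using Ex assms k t 1 by simp
    then show ?thesis using t k assms 1 \<open>v = 1\<close> unfolding sporadic_form_def M_def
      by (simp add: P Q)
  next
    case 2
    define D where "D = X ^ 2 + X + 1"
    have "geo 3 P = D * (X ^ 6 + X ^ 5 + X ^ 4 + X ^ 2 + 1)"
      unfolding t D_def 2 using X by (elim disjE) (simp_all add: geo_def numeral_eq_Suc one_pCons)
    then have "D dvd Q" unfolding Q by simp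
    then have "D = 1 \<or> Q dvd D" using irreducibleD'[OF irr(2)] by auto
    moreover have "degree D = 2" unfolding D_def using X by (elim disjE) (simp_all add: numeral_eq_Suc one_pCons)
    moreover have "degree P = 4" using degs(1) t(2,3) 2 by simp
    then have "degree Q = 8" using degs(5) assms(1,9) by simp
    ultimately show ?thesis using dvd_imp_degree_le[of Q D] by fastforce
  qed
qed

text \<open>The equation for \<open>Q\<close> becomes \<open>2 ^ \<delta> = 1 + 2 ^ \<gamma>\<close>, and then the one for \<open>P\<close> gives
  \<open>2 ^ n = 1 + a1 * 2 ^ \<alpha> + b1 * 2 ^ \<beta>\<close> with \<open>w = 2 ^ n + 1\<close>.  If exactly one of \<open>a1\<close>, \<open>b1\<close> is \<open>1\<close>,
  \<open>case_C1\<close> applies, up to exchanging \<open>X\<close> and \<open>X + 1\<close>.  If both are, \<open>P = geo 3 X\<close>, and the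
  equations for the linear factors give \<open>\<alpha> = \<beta>\<close>, a parity contradiction.\<close>

lemma case_w2: assumes "w2 = 1" shows result
proof -
  interpret sw: perfect_exponents "X + 1" P Q \<beta> \<alpha> \<gamma> \<delta> v u w b1 b2 a1 a2 w2 j i l k s by (rule swap_perfect_exponents)
  obtain n where n: "n > 0" "w = 2 ^ n + 1" "s = 1" "k = i * (2 ^ n - 1)" "l = j * (2 ^ n - 1)"
    using w_form assms by blast
  have z: "a2 = 0" "b2 = 0" using w2_a2 sw.w2_a2 assms by auto
  have Eq': "2 ^ \<delta> = 1 + (2::nat) ^ \<gamma>" using Eq assms z by simp
  have \<gamma>\<delta>: "\<gamma> = 0" "\<delta> = 1"
    using Eq' by (cases \<gamma> rule: pow2_cases; cases \<delta> rule: pow2_cases; presburger)+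
  have Ep': "2 ^ n = 1 + a1 * 2 ^ \<alpha> + b1 * (2::nat) ^ \<beta>" using Ep \<gamma>\<delta> n by simp
  consider "a1 = 0" "b1 = 0" | "a1 = 1" "b1 = 0" | "a1 = 0" "b1 = 1" | "a1 = 1" "b1 = 1"
    using bounds by linarith
  then show ?thesis
  proof cases
    case 1
    then show ?thesis using Ep' n(1) by simp
  next
    case 2
    then have "\<alpha> = 0" "n = 1"
      using Ep' n(1) by (cases \<alpha> rule: pow2_cases; cases n rule: pow2_cases; simp; presburger)+
    then show ?thesis using case_C1 2 z \<gamma>\<delta> n assms by simp
  next
    case 3
    then have "\<beta> = 0" "n = 1"
      using Ep' n(1) by (cases \<beta> rule: pow2_cases; cases n rule: pow2_cases; simp; presburger)+
    then show ?thesis using sw.case_C1 3 z \<gamma>\<delta> n assms by (simp add: swap_M add.assoc disj_commute)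
  next
    case 4
    obtain t where t: "i = 1" "j = 2 ^ t - 1" "u = 2 ^ t + 1" using U_eq_P 4 z by blast
    obtain t' where t': "j = 1" "v = 2 ^ t' + 1" "i = 2 ^ t' - 1" using sw.U_eq_P 4 z by blast
    have uv: "u = 3" "v = 3" using t t' by simp_all
    have "3 * 2 ^ \<alpha> = (2::nat) ^ \<beta> + (2 ^ n - 1)" "3 * 2 ^ \<beta> = (2::nat) ^ \<alpha> + (2 ^ n - 1)"
      using Ex Ey \<gamma>\<delta> n t(1) t'(1) uv by simp_all
    moreover have "2 ^ n = 1 + 2 ^ \<alpha> + (2::nat) ^ \<beta>" using Ep' 4 by simp
    ultimately have "2 ^ n = 1 + 2 * (2::nat) ^ \<alpha>" by linarith
    then show ?thesis using n(1) by (cases n rule: pow2_cases) (simp_all, presburger)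
  qed
qed

text \<open>Comparing derivatives at the root of \<open>X\<close> shows that \<open>j'\<close> is even, and then at the root of \<open>X + 1\<close>
  that \<open>l' = 1\<close>.  The equation collapses to \<open>(1 + X) ^ j' = 1 + X ^ j'\<close>, so \<open>j'\<close> and \<open>j' + 2\<close> are both
  powers of two.\<close>

lemma C4_exponents:
  assumes eq: "X ^ k' * (X + 1) ^ l' = X ^ (j' + 1) + (X + 1) ^ j' + 1"
    and kl: "k' \<ge> 2" "l' \<ge> 1" "j' \<ge> 1" "k' + l' = j' + 1" and \<beta>': "2 ^ \<beta>' = 1 + j' + l'"
  shows "j' = 2" "l' = 1" "k' = 2"
proof -
  obtain z where z: "poly X z = 0" "poly (X + 1) z = 1" using X_root by blast
  obtain z' where z': "poly X z' = 1" "poly (X + 1) z' = 0" using X1_root by blast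
  have pd: "pderiv (X + 1) = 1" by (simp add: pderiv_add)
  have d: "poly (pderiv (X ^ k' * (X + 1) ^ l')) x = poly (pderiv (X ^ (j' + 1) + (X + 1) ^ j' + 1)) x" for x
    by (simp only: eq)
  have "even j'" using d[of z] kl
    by (simp only: pderiv_mult pderiv_add pderiv_power pd degX poly_add poly_mult poly_power poly_smult z)
       (simp add: bit_of_nat power_0_left split: if_splits)
  then have l1: "l' = 1" using d[of z'] kl
    by (simp only: pderiv_mult pderiv_add pderiv_power pd degX poly_add poly_mult poly_power poly_smult z')
       (simp add: bit_of_nat power_0_left split: if_splits)
  then have k': "k' = j'" using kl by simp
  have "X ^ j' = (X + 1) ^ j' + 1" using eq unfolding k' l1 by (simp add: algebra_simps)
  then have "(1 + X) ^ j' = 1 + X ^ j'" by (simp add: bit_poly_add_eq_iff add.commute)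
  moreover have "j' > 0" using kl by simp
  ultimately obtain e where e: "j' = 2 ^ e" using Frobenius_binomial_exponent[OF X] by blast
  then have "e > 0" using \<open>even j'\<close> by (cases e) auto
  then have "j' = 2" using \<beta>' e l1
    by (cases e rule: pow2_cases; cases \<beta>' rule: pow2_cases; simp; presburger)
  then show "j' = 2" "l' = 1" "k' = 2" using l1 k' by auto
qed

text \<open>Each of \<open>P\<close>, \<open>Q\<close> is the reversal of the other.  Since \<open>P * Q + 1\<close> is divisible by \<open>X\<close> exactly once,
  exactly one of \<open>i\<close>, \<open>k\<close> is \<open>1\<close>; then \<open>C4_exponents\<close> applies to \<open>Q + 1\<close> or to \<open>P + 1\<close>.\<close>

lemma case_C4:
  assumes "a1 = 1" "a2 = 1" "b1 = 0" "b2 = 0" "s = 0" "k + l = i + j" "\<alpha> = 0" "\<delta> = 1" "\<gamma> = 1" "w = 1"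
    and Q: "Q = X ^ (i + j) + (X + 1) ^ j"
  shows result
proof -
  have PQ: "geo u X = P * Q" using U assms(1,2) by (simp add: M_def)
  have u: "u = Suc (2 * (i + j))" "u > 0" using degs(1-3) assms(1-10) by simp_all
  have v: "v = 1" using degs(4) assms(1-10) by simp
  have Ey': "2 ^ \<beta> = 1 + j + l" using Ey v assms(1-10) by simp
  have Pf: "P + 1 = X ^ i * (X + 1) ^ j" and Qf: "Q + 1 = X ^ k * (X + 1) ^ l"
    using P1 Q1 assms(1-10) by (simp_all add: M_def)
  have "geo u X = Q * P" using PQ by (simp add: mult.commute)
  from geo_eq_two_Mersenne[OF X irr(2,1) this u(2) pos(4,5) Qf]
  have P: "P = X ^ (k + l) + (X + 1) ^ l"
  proof (elim disjE exE conjE)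
    fix f assume f: "0 < f" "P + 1 = X ^ (2 ^ f + 1) * (X + 1) ^ (2 ^ f - 1) * Q ^ (2 ^ f - 1)"
    then have "M i j 0 0 = M (2 ^ f + 1) (2 ^ f - 1) 0 (2 ^ f - 1)"
      using P1 by (simp add: M_def)
    then have "(2::nat) ^ f - 1 = 0" unfolding M_inj by simp
    then show ?thesis using one_less_power[of "2::nat" f] f(1) by linarith
  qed
  have "P * Q = 1 + X * geo (u - 1) X" using geo_Suc_shift[of "u - 1" X] u PQ by simp
  then have PQ1: "P * Q + 1 = X * geo (u - 1) X" by (simp add: add.commute)
  have ndvd2: "\<not> X ^ 2 dvd P * Q + 1"
  proof
    obtain z where z: "poly X z = 0" "\<And>f. X dvd f \<longleftrightarrow> poly f z = 0" using X_root by blast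
    assume "X ^ 2 dvd P * Q + 1"
    then have "X dvd geo (u - 1) X" unfolding PQ1 using nz by (simp add: power2_eq_square)
    then show False using u pos by (simp add: z poly_geo)
  qed
  \<comment> \<open>Separates the contributions of \<open>i\<close> and \<open>k\<close> to the exponent of \<open>X\<close>.\<close>
  have sum: "P * Q + 1 = (P + 1) * (Q + 1) + ((P + 1) + (Q + 1))"
    by (simp add: algebra_simps)
  have "\<not> (i \<ge> 2 \<and> k \<ge> 2)"
  proof
    assume "i \<ge> 2 \<and> k \<ge> 2"
    then have "X ^ 2 dvd P + 1" "X ^ 2 dvd Q + 1"
      unfolding Pf Qf by (simp_all add: le_imp_power_dvd)
    then have "X ^ 2 dvd (P + 1) * (Q + 1) + ((P + 1) + (Q + 1))" by (simp only: dvd_add dvd_mult)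
    then show False using ndvd2 unfolding sum by blast
  qed
  moreover have "\<not> (i = 1 \<and> k = 1)"
  proof
    obtain z where z: "poly X z = 0" "poly (X + 1) z = 1" "\<And>f. X dvd f \<longleftrightarrow> poly f z = 0" using X_root by blast
    assume *: "i = 1 \<and> k = 1"
    then have "X ^ 2 dvd (P + 1) * (Q + 1)" unfolding Pf Qf by (simp add: power2_eq_square mult_dvd_mono)
    moreover have "X dvd (X + 1) ^ j + (X + 1) ^ l" unfolding z by (simp only: poly_add poly_power z) simp
    then have "X ^ 2 dvd (P + 1) + (Q + 1)" unfolding Pf Qf using *
      by (simp add: power2_eq_square mult_dvd_mono flip: distrib_left)
    ultimately have "X ^ 2 dvd (P + 1) * (Q + 1) + ((P + 1) + (Q + 1))" by (rule dvd_add)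
    then show False using ndvd2 unfolding sum by blast
  qed
  ultimately consider "i = 1" "k \<ge> 2" | "k = 1" "i \<ge> 2" using pos by linarith
  then have "i + j = 3 \<and> j + l = 3"
  proof cases
    case 1
    then show ?thesis using C4_exponents[of k l j \<beta>] Qf Q Ey' pos assms(6) by (simp add: add.commute)
  next
    case 2
    then show ?thesis using C4_exponents[of i j l \<beta>] Pf P Ey' pos assms(6) by (simp add: add.commute add.left_commute)
  qed
  then have "u = 7" "2 ^ \<beta> = (4::nat)" using u Ey' by simp_all
  then show ?thesis using assms(7-10) v PQ unfolding sporadic_form_def M_def
    by (simp add: mult.assoc)
qed

text \<open>The sub-case \<open>geo u X = Q\<close> leads to \<open>P = geo (2 ^ t + 1) (X + 1)\<close>, \<open>Q = geo (2 ^ t + 1) X\<close>, which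
  solves the exponent equations for every \<open>t\<close>; irreducibility leaves \<open>t \<le> 2\<close>, and \<open>P = Q\<close> for
  \<open>t = 1\<close>.  The sub-case \<open>geo u X = P * Q\<close> leads to \<open>case_C4\<close>.  All other combinations contradict the
  exponent equations or the degrees.\<close>

lemma case_Q_dvd_U:
  assumes "w2 = 0" "a2 = 1" "b2 = 0" "\<alpha> = 0" "\<delta> = 1" "w = 1"
  shows result
proof -
  interpret sw: perfect_exponents "X + 1" P Q \<beta> \<alpha> \<gamma> \<delta> v u w b1 b2 a1 a2 w2 j i l k s by (rule swap_perfect_exponents)
  have \<gamma>: "\<gamma> > 0" using pos(6) assms(6) by (intro gr0I) simp
  have Ep': "2 ^ \<gamma> = 1 + a1 + b1 * 2 ^ \<beta> + s" using Ep assms by simp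
  have Ex': "u = 2 ^ \<beta> + (2 ^ \<gamma> - 1) * i + k" and Ey': "2 ^ \<beta> * v = 1 + (2 ^ \<gamma> - 1) * j + l"
    using Ex Ey assms by simp_all
  show ?thesis
  proof (cases "a1 = 0")
    case a1: True
    from a1 assms(2) show ?thesis
    proof (cases rule: U_eq_Q)
      case (1 t)
      then have "b1 \<noteq> 0" using Ep' a1 \<gamma>
        by (intro notI; cases \<gamma> rule: pow2_cases; simp)
      then have b1: "b1 = 1" using bounds by simp
      then obtain t' where t': "j = 1" "i = 2 ^ t' - 1" "v = 2 ^ t' + 1" "P = geo (2 ^ t' + 1) (X + 1)"
        using sw.U_eq_P assms(3) by blast
      have \<beta>: "\<beta> = 0" "\<gamma> = 1" using Ep' a1 b1 1 \<gamma>
        by (cases \<beta> rule: pow2_cases; cases \<gamma> rule: pow2_cases; simp; presburger)+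
      have "(2::nat) ^ t = 2 ^ t'" using Ex' \<beta> 1 t' by simp
      then have tt': "t = t'" by simp
      have "t \<le> 2" using geo_Fermat_irreducible[OF X] 1 irr by blast
      then consider "t = 1" | "t = 2" using 1 by linarith
      then show ?thesis
      proof cases
        case t: 1
        have "geo 3 X = geo 3 (X + 1)"
          using X by (elim disjE) (simp_all add: geo_def numeral_eq_Suc one_pCons)
        moreover have "t' = 1" using tt' t by simp
        then have "P = geo 3 (X + 1)" using t'(4) by (simp add: numeral_3_eq_3)
        moreover have "Q = geo 3 X" using 1(6) t by (simp add: numeral_3_eq_3)
        ultimately show ?thesis using distinct(1) by simp
      next
        case t: 2
        then have A: "A = M 4 4 1 1"
          using 1 t' tt' \<beta> assms by simp
        have "t' = 2" using tt' t by simp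
        then have PQ: "P = geo 5 (X + 1)" "Q = geo 5 X" using t'(4) 1(6) t by simp_all
        have "M 4 4 1 1 = X ^ 4 * (X + 1) ^ 4 * Q * P" by (simp add: M_def ac_simps)
        also have "\<dots> = X ^ 4 * (X + 1) ^ 4 * geo 5 X * geo 5 (X + 1)" by (simp only: PQ)
        finally show ?thesis unfolding sporadic_form_def A by blast
      qed
    next
      case (2 t)
      have even: "even ((2::nat) ^ \<gamma>)" "even ((2::nat) ^ t)" using \<gamma> 2(1) by simp_all
      have eq: "2 ^ \<gamma> = 1 + b1 * 2 ^ \<beta> + (2::nat) ^ t" using Ep' a1 2(4) by simp
      have "b1 \<noteq> 0" using even eq by (intro notI) simp
      then have b1: "b1 = 1" using bounds by simp
      have "odd ((2::nat) ^ \<beta>)" using even eq b1 by (metis even_add even_plus_one_iff mult_1 add.commute)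
      then have \<beta>: "\<beta> = 0" by simp
      then have eq: "2 ^ \<gamma> = 2 + (2::nat) ^ t" using eq b1 by simp
      then have t: "t = 1" using 2(1) \<gamma>
        by (cases \<gamma> rule: pow2_cases; cases t rule: pow2_cases; simp; presburger)
      then have "2 ^ \<gamma> = (2::nat) ^ 2" using eq by simp
      then have "\<gamma> = 2" using power_inject_exp[of "2::nat" \<gamma> 2] by simp
      note bt = \<beta> t this
      then have "u = 3 * i + 2" "s = 2" using Ex' 2(2,4) bt by simp_all
      moreover have "u = Suc (k + l + s * (i + j))" using degs(3) a1 assms by (simp add: degs(2))
      ultimately show ?thesis using 2 bt pos by simp
    qed
  next
    case False
    then have a1: "a1 = 1" using bounds by simp
    from a1 assms(2) show ?thesis
    proof (cases rule: U_eq_PQ)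
      case 1
      show ?thesis
      proof (cases "b1 = 0")
        case True
        then have "\<gamma> = 1" using Ep' a1 1 by (cases \<gamma> rule: pow2_cases) simp_all
        then show ?thesis using case_C4 a1 assms True 1 by blast
      next
        case False
        then have b1: "b1 = 1" using bounds by simp
        then have j: "j = 1" using sw.U_eq_P assms(3) by blast
        have \<beta>: "\<beta> = 1" using Ep' a1 b1 1
          by (cases \<beta> rule: pow2_cases; cases \<gamma> rule: pow2_cases; simp; presburger)
        then have "2 ^ \<gamma> = (2::nat) ^ 2" using Ep' a1 b1 1 by simp
        then have "\<gamma> = 2" using power_inject_exp[of "2::nat" \<gamma> 2] by simp
        moreover note \<beta>
        moreover have "v = Suc (i + j)" using degs(4) b1 assms(3) by (simp add: degs(1))
        ultimately have "2 * (i + 2) = 4 + l" using Ey' j by simp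
        then have False using 1(2) j pos(2,4) by presburger
        then show ?thesis ..
      qed
    next
      case (2 f)
      have even: "even ((2::nat) ^ \<gamma>)" "even ((2::nat) ^ f)" using \<gamma> 2(1) by simp_all
      have eq: "2 ^ \<gamma> = 1 + b1 * 2 ^ \<beta> + (2::nat) ^ f" using Ep' a1 2(6) one_le_power[of "2::nat" f] by linarith
      have "b1 \<noteq> 0" using even eq by (intro notI) simp
      then have b1: "b1 = 1" using bounds by simp
      have "odd ((2::nat) ^ \<beta>)" using even eq b1 by (metis even_add even_plus_one_iff mult_1 add.commute)
      then have "\<beta> = 0" by simp
      moreover from this have "2 ^ \<gamma> = 2 + (2::nat) ^ f" using eq b1 by simp
      ultimately have "v = 1 + (1 + 2 ^ f) * j + l" using Ey' by simp
      moreover have "v = 2 + j" using degs(4) b1 assms(3) 2(2) by (simp add: degs(1))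
      moreover have "(1 + 2 ^ f) * j \<ge> j + 1" using pos(3) by (simp add: Suc_le_eq)
      ultimately have False using pos(5) by linarith
      then show ?thesis ..
    qed
  qed
qed

text \<open>If \<open>a1 = b1 = 1\<close>, then \<open>geo u X = geo u (X + 1)\<close>; multiplied by \<open>X * (X + 1)\<close> this reads
  \<open>(1 + X) ^ (u + 1) = 1 + X ^ (u + 1)\<close>, so \<open>u + 1\<close> is a power of two, while the exponent equations
  make it divisible by \<open>3\<close>.  The other cases are contradictory by parity, size or degree.\<close>

lemma case_Q_dvd_U_V:
  assumes "w2 = 0" "a2 = 1" "b2 = 1" "\<alpha> = 0" "\<beta> = 1" "\<delta> = 2" "w = 1"
  shows False
proof -
  interpret sw: perfect_exponents "X + 1" P Q \<beta> \<alpha> \<gamma> \<delta> v u w b1 b2 a1 a2 w2 j i l k s by (rule swap_perfect_exponents)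
  have \<gamma>: "\<gamma> > 0" using pos(6) assms(7) by (intro gr0I) simp
  have Ep': "2 ^ \<gamma> = 1 + a1 + 2 * b1 + 3 * s" using Ep assms by simp
  have Ex': "u = 2 + (2 ^ \<gamma> - 1) * i + 3 * k" and Ey': "2 * v = 1 + (2 ^ \<gamma> - 1) * j + 3 * l"
    using Ex Ey assms by simp_all
  consider "a1 = 0" "b1 = 0" | "a1 = 1" "b1 = 0" | "a1 = 0" "b1 = 1" | "a1 = 1" "b1 = 1"
    using bounds by linarith
  then show False
  proof cases
    case 1
    then obtain t where t: "k = 1" "s = 0 \<or> s = 2 ^ t" "l = 2 ^ t - 1" using U_eq_Q assms(2) by metis
    have "l = 1" using 1 sw.U_eq_Q assms(3) by metis
    then have "s = 0 \<or> s = 2" using t by auto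
    then show False using Ep' 1 \<gamma> by (cases \<gamma> rule: pow2_cases; elim disjE; simp; presburger)
  next
    case 2
    have "b1 = 0" "b2 = 1" using 2 assms by auto
    then show False
    proof (cases rule: sw.U_eq_Q)
      case (1 t)
      have "\<gamma> = 1" using Ep' 2 1 by (cases \<gamma> rule: pow2_cases) simp_all
      then have "j + 2 = 2 * 2 ^ t" using Ey' 1 by simp
      moreover have "i + j \<le> 2 ^ t" using deg_le degs(1,2) 1 by simp
      moreover have "(2::nat) ^ t \<ge> 2" using 1 by (cases t) auto
      ultimately show False using pos by linarith
    next
      case t: (2 t)
      have "t = 1" using Ep' 2 t \<gamma>
        by (cases \<gamma> rule: pow2_cases; cases t rule: pow2_cases; simp; presburger)
      then have "2 ^ \<gamma> = (2::nat) ^ 3" using Ep' 2 t by simp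
      then have "\<gamma> = 3" using power_inject_exp[of "2::nat" \<gamma> 3] by simp
      with \<open>t = 1\<close> have "2 * v = 11" using Ey' t by simp
      then show False by presburger
    qed
  next
    case 3
    obtain t where "s = 0 \<or> t > 0 \<and> s = 2 ^ t" using U_eq_Q 3 assms(2) by metis
    then have "even s" by auto
    then show False using Ep' 3 \<gamma> by (cases \<gamma>; simp; presburger)
  next
    case 4
    then have eq: "geo u X = geo v (X + 1)" using U V assms by simp
    have uv: "u = v" using degs(3,4) 4 assms by simp
    have "1 + (X + 1) = X" by (simp add: add.left_commute)
    then have geo_v: "X * geo v (X + 1) = 1 + (1 + X) ^ v"
      using geo_mult[of "X + 1" v] by (simp add: add.commute)
    have "(1 + X) * (1 + (1 + X) ^ u) = (1 + X) * (X * geo v (X + 1))"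
      unfolding geo_v uv by (rule refl)
    also have "\<dots> = (1 + X) * (X * geo u X)" by (simp only: eq)
    also have "\<dots> = X * (1 + X ^ u)" by (simp only: mult.left_commute[of "1 + X"] geo_mult)
    finally have "(1 + X) * (1 + (1 + X) ^ u) = X * (1 + X ^ u)" .
    then have "(1 + X) ^ (u + 1) = 1 + X ^ (u + 1)"
      by (simp add: algebra_simps bit_poly_add_eq_iff)
    then obtain e where e: "u + 1 = 2 ^ e" using Frobenius_binomial_exponent[OF X, of "u + 1"] by auto
    have "2 ^ \<gamma> - 1 = 3 * (1 + s)" using Ep' 4 by simp
    then have "u + 1 = 3 * (1 + (1 + s) * i + k)" using Ex' by (simp add: algebra_simps)
    then have "3 dvd (2::nat) ^ e" unfolding e[symmetric] by (metis dvd_triv_left)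
    then show False using prime_dvd_power[of "3::nat" 2 e] by simp
  qed
qed

text \<open>With \<open>w2 = 0\<close> the equation for \<open>Q\<close> is \<open>2 ^ \<delta> = 1 + a2 * 2 ^ \<alpha> + b2 * 2 ^ \<beta>\<close>, so either one of the
  summands is \<open>1\<close> and the other absent, or they are \<open>1\<close> and \<open>2\<close>.\<close>

theorem sporadic_form_A: result
proof (cases "w2 = 1")
  case True
  then show ?thesis by (rule case_w2)
next
  case False
  interpret sw: perfect_exponents "X + 1" P Q \<beta> \<alpha> \<gamma> \<delta> v u w b1 b2 a1 a2 w2 j i l k s by (rule swap_perfect_exponents)
  have w2: "w2 = 0" using False bounds by simp
  then have w: "w = 1" using degs(5) pos odd_pos[OF odd(3)] by (cases "w = 1") (auto simp: degs(1))
  have Eq': "2 ^ \<delta> = 1 + a2 * 2 ^ \<alpha> + b2 * (2::nat) ^ \<beta>" using Eq w2 by simp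
  consider "a2 = 0" "b2 = 0" | "a2 = 1" "b2 = 0" | "a2 = 0" "b2 = 1" | "a2 = 1" "b2 = 1"
    using bounds by linarith
  then show ?thesis
  proof cases
    case 1
    then show ?thesis using Eq' pos(1) by simp
  next
    case 2
    then have "\<alpha> = 0" "\<delta> = 1"
      using Eq' pos(1) by (cases \<alpha> rule: pow2_cases; cases \<delta> rule: pow2_cases; simp; presburger)+
    then show ?thesis using case_Q_dvd_U 2 w w2 by blast
  next
    case 3
    then have "\<beta> = 0" "\<delta> = 1"
      using Eq' pos(1) by (cases \<beta> rule: pow2_cases; cases \<delta> rule: pow2_cases; simp; presburger)+
    then show ?thesis using sw.case_Q_dvd_U 3 w w2 by (simp add: swap_M add.assoc disj_commute)
  next
    case 4
    then have \<alpha>\<beta>: "\<alpha> = 0 \<and> \<beta> = 1 \<or> \<beta> = 0 \<and> \<alpha> = 1"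
      using Eq' pos(1)
      by (cases \<alpha> rule: pow2_cases; cases \<beta> rule: pow2_cases; cases \<delta> rule: pow2_cases; simp; presburger)
    then have "2 ^ \<delta> = (2::nat) ^ 2" using Eq' 4 by auto
    then have "\<delta> = 2" using power_inject_exp[of "2::nat" \<delta> 2] by simp
    then show ?thesis
      using \<alpha>\<beta> case_Q_dvd_U_V[OF w2 4 _ _ _ w] sw.case_Q_dvd_U_V[OF w2 4(2,1) _ _ _ w] by auto
  qed
qed

end

section \<open>The sum of divisors\<close>

lemma sigma_coprime_mult:
  assumes "coprime a b"
  shows "sigma (a * b) = sigma a * sigma b"
proof -
  have "bij_betw (\<lambda>(d, e). d * e) ({d. d dvd a} \<times> {e. e dvd b}) {f. f dvd a * b}"
    unfolding bij_betw_def
  proof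
    show "inj_on (\<lambda>(d, e). d * e) ({d. d dvd a} \<times> {e. e dvd b})"
    proof (rule inj_onI, clarify)
      fix d e d' e'
      assume dvd: "d dvd a" "d' dvd a" "e dvd b" "e' dvd b" and eq: "d * e = d' * e'"
      then have "coprime d e'" "coprime d' e" "coprime e d'" "coprime e' d"
        using assms by (auto intro: coprime_divisors simp: coprime_commute)
      then have "d dvd d'" "d' dvd d" "e dvd e'" "e' dvd e"
        using eq by (metis coprime_dvd_mult_left_iff coprime_dvd_mult_right_iff dvd_triv_left dvd_triv_right)+
      then show "d = d' \<and> e = e'" by (simp add: bit_poly_dvd_antisym)
    qed
    show "(\<lambda>(d, e). d * e) ` ({d. d dvd a} \<times> {e. e dvd b}) = {f. f dvd a * b}"
      using division_decomp[of _ a b] by (fastforce intro: mult_dvd_mono)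
  qed
  then have "sigma (a * b) = (\<Sum>(d, e)\<in>{d. d dvd a} \<times> {e. e dvd b}. d * e)"
    unfolding sigma_def by (subst sum.reindex_bij_betw[symmetric]) (auto simp: case_prod_unfold)
  then show ?thesis by (simp add: sigma_def sum_product sum.cartesian_product)
qed

lemma sigma_prime_power:
  assumes "irreducible p"
  shows "sigma (p ^ n) = geo (n + 1) p"
proof -
  have p: "degree p > 0" "p \<noteq> 0" using assms irreducible_degree_pos by (auto simp: irreducible_def)
  have "{d. d dvd p ^ n} = (\<lambda>i. p ^ i) ` {..<n + 1}"
  proof (intro equalityI subsetI)
    fix d assume "d \<in> {d. d dvd p ^ n}"
    then obtain m where "m \<le> n" "d = p ^ m"
      using divides_primepow[of p d n] assms by (auto simp: bit_poly_prime_iff)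
    then show "d \<in> (\<lambda>i. p ^ i) ` {..<n + 1}" by simp
  qed (auto simp: le_imp_power_dvd)
  moreover have "inj_on (\<lambda>i. p ^ i) {..<n + 1}"
  proof (rule inj_onI)
    fix i j assume "p ^ i = p ^ j"
    then have "degree (p ^ i) = degree (p ^ j)" by simp
    then show "i = j" using p by (simp add: degree_power_eq)
  qed
  ultimately show ?thesis
    unfolding sigma_def geo_def by (simp add: sum.reindex)
qed

lemma sigma_prod_prime_powers:
  assumes "finite S" "\<And>p. p \<in> S \<Longrightarrow> irreducible p"
  shows "sigma (\<Prod>p\<in>S. p ^ f p) = (\<Prod>p\<in>S. geo (f p + 1) p)"
  using assms
proof (induction S rule: finite_induct)
  case (insert p S)
  have "coprime p q" if "q \<in> S" for q
    using insert that by (intro primes_coprime) (auto simp: bit_poly_prime_iff)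
  then have "coprime (p ^ f p) (\<Prod>q\<in>S. q ^ f q)"
    by (intro prod_coprime_right) simp
  then show ?case using insert by (simp add: sigma_coprime_mult sigma_prime_power)
qed (simp add: sigma_def)

text \<open>If \<open>X + 1\<close> does not divide \<open>A\<close>, it divides no \<open>geo (n + 1) p\<close> with \<open>p ^ n\<close> a component of \<open>A\<close>;
  evaluation at its root makes every exponent \<open>n\<close> even.  Evaluation of \<open>sigma A\<close> at the root of \<open>X\<close>
  then gives \<open>1\<close>, although \<open>X\<close> divides \<open>A\<close>.\<close>

lemma perfect_linear_factor:
  assumes X: "X = pX \<or> X = pX + 1" and A: "A \<noteq> 0" "perfect_poly A" "X dvd A"
  shows "X + 1 dvd A"
proof (rule ccontr)
  assume ndvd: "\<not> X + 1 dvd A"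
  define f where "f p = multiplicity p A" for p
  have "X + 1 = pX \<or> X + 1 = pX + 1" using X by (auto simp: one_pCons)
  then obtain y where y: "poly (X + 1 + 1) y = 1" "\<And>f. X + 1 dvd f \<longleftrightarrow> poly f y = 0"
    using linear_root by blast
  obtain z where z: "poly X z = 0" "\<And>f. X dvd f \<longleftrightarrow> poly f z = 0"
    using linear_root[OF X] by blast
  have irr: "irreducible p" "p dvd A" if "p \<in> prime_factors A" for p
    using that by (auto simp: bit_poly_prime_iff in_prime_factors_iff)
  have prod: "A = (\<Prod>p\<in>prime_factors A. p ^ f p)"
    using prod_prime_factors[OF A(1)] by (simp add: f_def)
  have "sigma (\<Prod>p\<in>prime_factors A. p ^ f p) = (\<Prod>p\<in>prime_factors A. geo (f p + 1) p)"
    by (rule sigma_prod_prime_powers) (auto dest: irr)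
  then have A_geo: "A = (\<Prod>p\<in>prime_factors A. geo (f p + 1) p)"
    using A(2) prod by (simp add: perfect_poly_def)
  have f_even: "even (f p)" if p: "p \<in> prime_factors A" for p
  proof -
    have "geo (f p + 1) p dvd A" by (subst A_geo) (use p in \<open>auto intro: dvd_prodI\<close>)
    then have "\<not> X + 1 dvd geo (f p + 1) p" "\<not> X + 1 dvd p" using ndvd irr(2)[OF p] dvd_trans by blast+
    then show ?thesis unfolding y(2) by (simp add: poly_geo)
  qed
  have "poly A z = (\<Prod>p\<in>prime_factors A. poly (geo (f p + 1) p) z)"
    by (subst A_geo) (simp add: poly_prod)
  also have "\<dots> = 1" using f_even by (intro prod.neutral) (simp add: poly_geo)
  finally show False using A(3) z(2) by simp
qed

section \<open>The sporadic polynomials are perfect\<close>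

text \<open>A factorisation has a factor of degree at most two, and the only polynomial of degree one or two
  without roots is \<open>x ^ 2 + x + 1\<close>.  A polynomial of degree at most three even has a factor of degree
  one.\<close>

lemma irreducible_degree_le_5:
  fixes f :: "bit poly"
  assumes "degree f > 0" "degree f \<le> 5" "poly f 0 \<noteq> 0" "poly f 1 \<noteq> 0"
    and quad: "degree f \<le> 3 \<or> \<not> [:1, 1, 1:] dvd f"
  shows "irreducible f"
proof -
  have *: "degree g = 0 \<or> degree g \<ge> 3 \<or> degree g = 2 \<and> [:1, 1, 1:] dvd f" if gf: "g dvd f" for g
  proof (rule ccontr)
    assume neg: "\<not> ?thesis"
    then have "degree g > 0" "degree g \<le> 2" by auto
    obtain h where "f = g * h" using gf by blast
    then have r: "poly g 0 = 1" "poly g 1 = 1" using assms(3,4) by auto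
    obtain c0 c1 c2 where g: "g = [:c0, c1, c2:]"
    proof
      show "g = [:coeff g 0, coeff g 1, coeff g 2:]"
        using \<open>degree g \<le> 2\<close>
        by (intro poly_eqI) (auto simp: coeff_pCons coeff_eq_0 numeral_2_eq_2 split: nat.split)
    qed
    have "c0 = 1" "c1 = c2" using r by (cases c0; cases c1; cases c2; simp add: g)+
    moreover have "c2 \<noteq> 0" using \<open>degree g > 0\<close> calculation by (cases c2) (auto simp: g)
    ultimately show False using neg gf by (simp add: g)
  qed
  show ?thesis
  proof (rule irreducibleI)
    show "f \<noteq> 0" "\<not> is_unit f" using assms(1) by auto
    fix g h assume gh: "f = g * h"
    then have nz: "g \<noteq> 0" "h \<noteq> 0" using assms(1) by auto
    then have "degree f = degree g + degree h" using gh by (simp add: degree_mult_eq)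
    moreover have "g dvd f" "h dvd f" using gh by auto
    ultimately have "degree g = 0 \<or> degree h = 0" using *[of g] *[of h] quad assms(2) by arith
    then show "is_unit g \<or> is_unit h" using bit_poly_degree_0 nz by auto
  qed
qed

lemma quadratic_remainder_not_dvd:
  assumes "(f :: bit poly) = [:1, 1, 1:] * q + r" "r \<noteq> 0" "degree r < 2"
  shows "\<not> [:1, 1, 1:] dvd f"
proof
  assume "[:1, 1, 1:] dvd f"
  then have "[:1, 1, 1:] dvd r" unfolding assms(1) by (simp only: dvd_add_right_iff dvd_triv_left)
  then have "degree [:1, 1, 1 :: bit:] \<le> degree r" using assms(2) by (rule dvd_imp_degree_le)
  then show False using assms(3) by simp
qed

lemma small_irreducibles_pX:
  "irreducible (pX ^ 2 + pX + 1)" "irreducible (pX ^ 4 + pX + 1)" "irreducible (geo 5 pX)"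
  "irreducible (pX ^ 3 + pX ^ 2 + 1)" "irreducible (pX ^ 3 + pX + 1)"
proof -
  have e: "pX ^ 2 + pX + 1 = [:1, 1, 1:]" "pX ^ 4 + pX + 1 = [:1, 1, 0, 0, 1:]"
    "geo 5 pX = [:1, 1, 1, 1, 1:]" "pX ^ 3 + pX ^ 2 + 1 = [:1, 0, 1, 1:]"
    "pX ^ 3 + pX + 1 = [:1, 1, 0, 1:]"
    by (simp_all add: geo_def numeral_eq_Suc one_pCons)
  have nd4: "\<not> [:1, 1, 1:] dvd ([:1, 1, 0, 0, 1:] :: bit poly)"
    by (rule quadratic_remainder_not_dvd[of _ "[:0, 1, 1:]" 1]) (simp_all add: one_pCons)
  have nd5: "\<not> [:1, 1, 1:] dvd ([:1, 1, 1, 1, 1:] :: bit poly)"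
    by (rule quadratic_remainder_not_dvd[of _ "[:0, 0, 1:]" "[:1, 1:]"]) simp_all
  show "irreducible (pX ^ 2 + pX + 1)"
    unfolding e by (rule irreducible_degree_le_5) simp_all
  show "irreducible (pX ^ 3 + pX ^ 2 + 1)"
    unfolding e by (rule irreducible_degree_le_5) simp_all
  show "irreducible (pX ^ 3 + pX + 1)"
    unfolding e by (rule irreducible_degree_le_5) simp_all
  show "irreducible (pX ^ 4 + pX + 1)"
    unfolding e by (rule irreducible_degree_le_5) (simp_all add: nd4)
  show "irreducible (geo 5 pX)"
    unfolding e by (rule irreducible_degree_le_5) (simp_all add: nd5)
qed

lemma small_irreducibles:
  assumes "X = pX \<or> X = pX + 1"
  shows "irreducible (X ^ 2 + X + 1)" "irreducible (X ^ 4 + X + 1)" "irreducible (geo 5 X)"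
    "irreducible (X ^ 3 + X ^ 2 + 1)" "irreducible (X ^ 3 + X + 1)"
  using assms small_irreducibles_pX small_irreducibles_pX[THEN shift_irreducible[THEN iffD2]]
  by (auto simp only: shift_simps shift_geo shift_1 shift_pX)

context two_odd_primes
begin

lemma M_perfect_even:
  assumes "e > 0" "f > 0" "g > 0" "h > 0"
    and "geo (e + 1) X * geo (f + 1) (X + 1) * geo (g + 1) P * geo (h + 1) Q = M e f g h"
  shows "perfect_poly (M e f g h) \<and> even_poly (M e f g h) \<and> omega (M e f g h) = 4"
proof (intro conjI)
  have "coprime X (X + 1)" "coprime X P" "coprime (X + 1) P"
    "coprime X Q" "coprime (X + 1) Q" "coprime P Q"
    using irreducible_coprime irr irrX ndvd by blast+
  then have "coprime (X ^ e) ((X + 1) ^ f)" "coprime (X ^ e * (X + 1) ^ f) (P ^ g)"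
    "coprime (X ^ e * (X + 1) ^ f * P ^ g) (Q ^ h)"
    by (simp_all add: coprime_mult_left_iff)
  then have "sigma (M e f g h) = sigma (X ^ e) * sigma ((X + 1) ^ f) * sigma (P ^ g) * sigma (Q ^ h)"
    unfolding M_def by (simp only: sigma_coprime_mult)
  then show "perfect_poly (M e f g h)"
    using assms(5) irr irrX by (simp add: perfect_poly_def sigma_prime_power)
  have "X dvd pX ^ 2 + pX"
  proof -
    have "pX ^ 2 + pX = X * (X + 1)" using X by (elim disjE) (simp_all add: numeral_2_eq_2 one_pCons)
    then show ?thesis by simp
  qed
  then have "X dvd gcd (M e f g h) (pX ^ 2 + pX)"
    using dvd_M_iff(1)[of e f g h] assms(1) by (intro gcd_greatest) blast+
  moreover have "\<not> X dvd 1" using irrX(1) by (simp add: irreducible_def)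
  ultimately show "even_poly (M e f g h)" unfolding even_poly_def by metis
  have "{p. irreducible p \<and> p dvd M e f g h} = {X, X + 1, P, Q}"
  proof
    show "{X, X + 1, P, Q} \<subseteq> {p. irreducible p \<and> p dvd M e f g h}"
      using irr irrX assms by (auto simp: dvd_M_iff)
    show "{p. irreducible p \<and> p dvd M e f g h} \<subseteq> {X, X + 1, P, Q}"
    proof
      fix p assume "p \<in> {p. irreducible p \<and> p dvd M e f g h}"
      then have p: "irreducible p" "p dvd M e f g h" by auto
      then have "p dvd X ^ e \<or> p dvd (X + 1) ^ f \<or> p dvd P ^ g \<or> p dvd Q ^ h"
        unfolding M_def by (simp only: irreducible_dvd_mult disj_assoc)
      then have "p dvd X \<or> p dvd X + 1 \<or> p dvd P \<or> p dvd Q"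
        using irreducible_dvd_power[OF p(1)] by blast
      then show "p \<in> {X, X + 1, P, Q}"
        using irr irrX irreducible_dvd_irreducible[OF p(1)] by blast
    qed
  qed
  then show "omega (M e f g h) = 4" using distinct degX(4) by (auto simp: omega_def)
qed

end

lemma geo_values:
  assumes "Z = pX \<or> Z = pX + 1"
  shows "geo 5 Z = Z ^ 4 + Z ^ 3 + Z ^ 2 + Z + 1"
    "geo 5 (Z + 1) = Z ^ 4 + Z ^ 3 + 1"
    "geo 7 Z = (Z ^ 3 + Z ^ 2 + 1) * (Z ^ 3 + Z + 1)"
  using assms by (elim disjE; simp add: geo_def numeral_eq_Suc one_pCons)+

lemma sporadic_form_perfect:
  assumes Z: "Z = pX \<or> Z = pX + 1" and A: "sporadic_form A Z"
  shows "perfect_poly A \<and> even_poly A \<and> omega A = 4"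
proof -
  note irr = small_irreducibles[OF Z]
  have Z1: "Z + 1 = pX \<or> Z + 1 = pX + 1" using Z by (auto simp: one_pCons)
  consider "A = Z ^ 2 * (Z + 1) * (Z ^ 2 + Z + 1) ^ 2 * (Z ^ 4 + Z + 1)"
    | "A = Z ^ 4 * (Z + 1) ^ 4 * geo 5 Z * geo 5 (Z + 1)"
    | "A = Z ^ 6 * (Z + 1) ^ 3 * (Z ^ 3 + Z ^ 2 + 1) * (Z ^ 3 + Z + 1)"
    using A unfolding sporadic_form_def geo_values(3)[OF Z] by (auto simp only: mult.assoc)
  then show ?thesis
  proof cases
    case 1
    interpret two_odd_primes Z "Z ^ 2 + Z + 1" "Z ^ 4 + Z + 1"
      by unfold_locales (use irr Z in \<open>auto simp: numeral_eq_Suc one_pCons\<close>)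
    have "geo (2 + 1) Z * geo (1 + 1) (Z + 1) * geo (2 + 1) (Z ^ 2 + Z + 1) * geo (1 + 1) (Z ^ 4 + Z + 1) = M 2 1 2 1"
      unfolding M_def using Z by (elim disjE) (simp_all add: geo_def numeral_eq_Suc one_pCons)
    then show ?thesis using M_perfect_even[of 2 1 2 1] 1 by (simp add: M_def)
  next
    case 2
    interpret two_odd_primes Z "geo 5 Z" "geo 5 (Z + 1)"
      by unfold_locales (use irr small_irreducibles[OF Z1] Z in \<open>auto simp: geo_def numeral_eq_Suc one_pCons\<close>)
    have "geo (4 + 1) Z * geo (4 + 1) (Z + 1) * geo (1 + 1) (geo 5 Z) * geo (1 + 1) (geo 5 (Z + 1)) = M 4 4 1 1"
      unfolding M_def using Z by (elim disjE) (simp_all add: geo_def numeral_eq_Suc one_pCons)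
    then show ?thesis using M_perfect_even[of 4 4 1 1] 2 by (simp add: M_def)
  next
    case 3
    interpret two_odd_primes Z "Z ^ 3 + Z ^ 2 + 1" "Z ^ 3 + Z + 1"
      by unfold_locales (use irr Z in \<open>auto simp: numeral_eq_Suc one_pCons\<close>)
    have "geo (6 + 1) Z * geo (3 + 1) (Z + 1) * geo (1 + 1) (Z ^ 3 + Z ^ 2 + 1) * geo (1 + 1) (Z ^ 3 + Z + 1) = M 6 3 1 1"
      unfolding M_def using Z by (elim disjE) (simp_all add: geo_def numeral_eq_Suc one_pCons)
    then show ?thesis using M_perfect_even[of 6 3 1 1] 3 by (simp add: M_def)
  qed
qed

text \<open>The form with \<open>geo 5 X * geo 5 (X + 1)\<close> is symmetric in the two linear polynomials, which is why two
  choices of \<open>X\<close> in three forms give only five polynomials.\<close>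

lemma sporadic_form_iff:
  "(\<exists>Z. (Z = pX \<or> Z = pX + 1) \<and> sporadic_form A Z) \<longleftrightarrow> A \<in> {C1, C2, C3, C4, C5}"
proof -
  define Y where "Y = pX + 1"
  have "shift Y = pX" using shift_shift[of pX] by (simp only: shift_pX Y_def)
  then have Y: "Y + 1 = pX" "shift pX = Y" "shift Y = pX" by (simp_all add: Y_def add.assoc)
  have "C1 = pX ^ 2 * Y * (pX ^ 2 + pX + 1) ^ 2 * (pX ^ 4 + pX + 1)" by (simp only: C1_def Y_def)
  moreover have C3: "C3 = pX ^ 4 * Y ^ 4 * geo 5 pX * geo 5 Y"
    using geo_values(1,2)[of pX] by (simp only: C3_def Y_def simp_thms)
  moreover have C4: "C4 = pX ^ 6 * Y ^ 3 * geo 7 pX"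
    using geo_values(3)[of pX] by (simp only: C4_def Y_def simp_thms mult.assoc)
  ultimately have "sporadic_form A pX \<longleftrightarrow> A \<in> {C1, C3, C4}"
    unfolding sporadic_form_def Y_def by (simp only: insert_iff empty_iff simp_thms)
  moreover have "C2 = Y ^ 2 * pX * (Y ^ 2 + Y + 1) ^ 2 * (Y ^ 4 + Y + 1)"
    unfolding C2_def C1_def by (simp only: Y_def[symmetric] shift_simps[folded Y_def] shift_1[folded Y_def] Y(2,3)[folded Y_def])
  moreover have "C3 = Y ^ 4 * pX ^ 4 * geo 5 Y * geo 5 pX" unfolding C3 by (simp only: ac_simps)
  moreover have "C5 = Y ^ 6 * pX ^ 3 * geo 7 Y"
    unfolding C5_def C4 by (simp only: Y_def[symmetric] shift_simps[folded Y_def] shift_geo[folded Y_def] Y(2,3)[folded Y_def])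
  ultimately have "sporadic_form A pX \<or> sporadic_form A Y \<longleftrightarrow> A \<in> {C1, C2, C3, C4, C5}"
    unfolding sporadic_form_def[of A Y] Y(1) by (simp only: insert_iff empty_iff simp_thms) blast
  moreover have "(\<exists>Z. (Z = pX \<or> Z = pX + 1) \<and> sporadic_form A Z) \<longleftrightarrow> sporadic_form A pX \<or> sporadic_form A Y"
    unfolding Y_def by blast
  ultimately show ?thesis by blast
qed

section \<open>The classification\<close>

lemma perfect_imp_sporadic:
  assumes "A \<noteq> 0" "perfect_poly A" "even_poly A" "omega A = 4"
  shows "\<exists>Z. (Z = pX \<or> Z = pX + 1) \<and> sporadic_form A Z"
proof -
  have "\<exists>X. (X = pX \<or> X = pX + 1) \<and> X dvd A"
  proof (rule ccontr)
    assume "\<not> ?thesis"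
    then have "\<not> pX dvd A" "\<not> pX + 1 dvd A" by blast+
    moreover have "irreducible pX" "irreducible (pX + 1)" by (auto intro!: degree_1_irreducible simp: one_pCons)
    ultimately have "coprime (pX * (pX + 1)) A"
      using irreducible_coprime by (simp only: coprime_mult_left_iff) blast
    moreover have "pX * (pX + 1) = pX ^ 2 + pX" by (simp add: algebra_simps power2_eq_square)
    ultimately have "coprime A (pX ^ 2 + pX)" by (simp add: coprime_commute)
    then show False using assms(3) by (simp add: even_poly_def coprime_iff_gcd_eq_1)
  qed
  then obtain X where hX: "X = pX \<or> X = pX + 1" "X dvd A" by blast
  have hX1: "X + 1 dvd A" using perfect_linear_factor[OF hX(1) assms(1,2) hX(2)] .
  have irrX: "irreducible X" "irreducible (X + 1)" "X \<noteq> X + 1"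
    using hX by (auto intro!: degree_1_irreducible simp: one_pCons)
  define S where "S = {P. irreducible P \<and> P dvd A}"
  have S: "S = prime_factors A" using assms(1) by (auto simp: S_def bit_poly_prime_iff in_prime_factors_iff)
  have "card S = 4" using assms(4) by (simp add: S_def omega_def)
  moreover have "X \<in> S" "X + 1 \<in> S" using hX hX1 irrX by (auto simp: S_def)
  ultimately have "card (S - {X, X + 1}) = 2" using irrX by (simp add: card_Diff_subset)
  then obtain P' Q' where PQ': "S - {X, X + 1} = {P', Q'}" "P' \<noteq> Q'" by (auto simp: card_2_iff)
  obtain P Q where PQ: "S - {X, X + 1} = {P, Q}" "P \<noteq> Q" "degree P \<le> degree Q"
    using PQ' by (metis insert_commute linear)
  then have inS: "P \<in> S" "Q \<in> S" "P \<notin> {X, X + 1}" "Q \<notin> {X, X + 1}" by blast+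
  have S4: "S = {X, X + 1, P, Q}" using PQ(1) \<open>X \<in> S\<close> \<open>X + 1 \<in> S\<close> by blast
  interpret two_odd_primes X P Q
    using hX inS PQ by unfold_locales (auto simp: S_def)
  define f where "f p = multiplicity p A" for p
  have f: "f p > 0" if "p \<in> S" for p
    using that unfolding S prime_factors_multiplicity f_def by simp
  have A: "A = (\<Prod>p\<in>S. p ^ f p)" using prod_prime_factors[OF assms(1)] S by (simp add: f_def)
  have "finite S" using S by simp
  moreover have "irreducible p" if "p \<in> S" for p using that by (simp add: S_def)
  ultimately have "sigma A = (\<Prod>p\<in>S. geo (f p + 1) p)"
    unfolding A by (rule sigma_prod_prime_powers)
  then have "A = (\<Prod>p\<in>S. geo (f p + 1) p)" using assms(2) by (simp add: perfect_poly_def)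
  then have gA: "A = geo (f X + 1) X * geo (f (X + 1) + 1) (X + 1) * geo (f P + 1) P * geo (f Q + 1) Q"
    unfolding S4 using distinct degX(4) by (simp add: mult.assoc)
  have AM: "A = M (f X) (f (X + 1)) (f P) (f Q)"
    unfolding M_def A S4 using distinct degX(4) by (simp add: mult.assoc)
  obtain \<alpha> \<beta> \<gamma> \<delta> u v w a1 a2 b1 b2 w2 i j k l s where
    c: "perfect_exponents X P Q \<alpha> \<beta> \<gamma> \<delta> u v w a1 a2 b1 b2 w2 i j k l s"
    "f X = 2 ^ \<alpha> * u - 1" "f (X + 1) = 2 ^ \<beta> * v - 1" "f P = 2 ^ \<gamma> * w - 1" "f Q = 2 ^ \<delta> - 1"
    by (rule perfect_exponents_exist[OF PQ(3) f[OF \<open>X \<in> S\<close>] f[OF \<open>X + 1 \<in> S\<close>] f[OF inS(1)] f[OF inS(2)]])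
      (use gA AM in \<open>simp_all only:\<close>)
  have "sporadic_form A X \<or> sporadic_form A (X + 1)"
    using perfect_exponents.sporadic_form_A[OF c(1)] AM c(2-5) by simp
  then show ?thesis using hX(1) X1 by blast
qed

theorem theorem2p10:
  fixes A :: "bit poly"
  assumes "A \<noteq> 0"
  shows "perfect_poly A \<and> even_poly A \<and> omega A = 4 \<longleftrightarrow> A \<in> {C1, C2, C3, C4, C5}"
  unfolding sporadic_form_iff[symmetric]
  using perfect_imp_sporadic[OF assms] sporadic_form_perfect by blast

end
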